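(* Let $\sigma_1,\sigma_2>0$ be fixed constants with $\sigma_1^2<\sigma_2^2$ (increasing variances). For each positive integer $n$, let $M_n^{\uparrow}$ denote the maximal displacement at time $n$ of the two-variance binary branching random walk with parameters $(n,\sigma_1,\sigma_2)$ (defined in the context). Then, as a sequence indexed by $n$, $$M_n^{\uparrow}=\left(\sqrt{(\sigma_1^2+\sigma_2^2)\log 2}\right)n-\frac{\sqrt{\sigma_1^2+\sigma_2^2}}{4\sqrt{\log 2}}\log n+O_P(1),$$ which is of the form $$M_n=\left(\sqrt{2\log 2}\;\sigma_{\mathrm{eff}}\right)n-\beta\frac{\sigma_{\mathrm{eff}}}{\sqrt{2\log 2}}\log n+O_P(1)$$ with $\sigma_{\mathrm{eff}}=\sqrt{\frac{\sigma_1^2+\sigma_2^2}{2}}$ and $\beta=\frac12$.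
   Context: Two-variance binary branching random walk with parameters $(n,\sigma_1,\sigma_2)$: start with one particle at location $0\in\mathbb{R}$ at time $0$. If $v$ is a particle at location $S_v$ at time $k$ ($0\le k<n$), then at time $k+1$ it dies and gives birth to exactly two particles $v1,v2$, which move independently to new locations $S_{v1},S_{v2}$; each increment $S_{vi}-S_v$ is independent of $S_v$ and is distributed as the centered normal $N(0,\sigma_1^2)$ if $k<n/2$ and as $N(0,\sigma_2^2)$ if $n/2\le k<n$. All increments attached to distinct particles are mutually independent. Let $\mathbb{D}_n$ be the set of the $2^n$ particles at time $n$. The maximal displacement is $M_n=\max_{v\in\mathbb{D}_n}S_v$; it is written $M_n^{\uparrow}$ when $\sigma_1^2<\sigma_2^2$. Note that the variance profile depends on $n$, so that for each $n$ a separate branching random walk is considered. Notation $O_P(1)$ (stochastic boundedness): a sequence of random variables $R_n$ satisfies $R_n=O_P(1)$ if for every $\epsilon>0$ there exists $M$ such that $P(|R_n|>M)<\epsilon$ for all $n$. An equation $M_n=a_n+O_P(1)$ means $M_n-a_n=O_P(1)$. Here $\log$ is the natural logarithm. *)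

theory Defs
  imports "HOL-Probability.Probability"
begin

text \<open>
  Particles are the nodes of the infinite binary tree, addressed by words over the two-letter
  alphabet \<^typ>\<open>bool\<close>: the root is \<^term>\<open>[]\<close>, the two children of \<open>v\<close> are \<open>v @ [False]\<close> and
  \<open>v @ [True]\<close>, and a particle alive at time \<open>k\<close> is a word of length \<open>k\<close>.
\<close>

definition particles :: "nat \<Rightarrow> bool list set" where
  "particles k = {v. length v = k}"

text \<open>
  \<open>S v\<close> is the location of particle \<open>v\<close>; only words of length at most \<open>n\<close> are constrained.
  The increment leading to a particle \<open>v \<noteq> []\<close> is \<open>S v - S (butlast v)\<close>. The location of a
  particle is the sum of the increments along its ancestral line, so mutual independence of the
  increments includes the independence of a new increment from the location of the parent.
  The second argument of \<^const>\<open>normal_density\<close> is the standard deviation.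
\<close>

locale two_variance_brw = prob_space M
  for M :: "'a measure" and n :: nat and \<sigma>\<^sub>1 \<sigma>\<^sub>2 :: real and S :: "bool list \<Rightarrow> 'a \<Rightarrow> real" +
  assumes root: "\<And>\<omega>. \<omega> \<in> space M \<Longrightarrow> S [] \<omega> = 0"
    and increment_distr: "\<And>k v b. k < n \<Longrightarrow> v \<in> particles k \<Longrightarrow>
      distributed M lborel (\<lambda>\<omega>. S (v @ [b]) \<omega> - S v \<omega>)
        (normal_density 0 (if real k < real n / 2 then \<sigma>\<^sub>1 else \<sigma>\<^sub>2))"
    and increments_indep: "indep_vars (\<lambda>_. borel) (\<lambda>v \<omega>. S v \<omega> - S (butlast v) \<omega>)
      (\<Union>k\<in>{1..n}. particles k)"

definition max_displacement :: "nat \<Rightarrow> (bool list \<Rightarrow> 'a \<Rightarrow> real) \<Rightarrow> 'a \<Rightarrow> real" where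
  "max_displacement n S \<omega> = Max ((\<lambda>v. S v \<omega>) ` particles n)"

text \<open>
  Stochastic boundedness of a sequence indexed by the positive integers. The \<open>n\<close>-th variable may
  live on its own probability space. Measurability is required explicitly because
  \<^const>\<open>measure\<close> is 0 on non-measurable sets.
\<close>

definition bounded_in_probability :: "(nat \<Rightarrow> 'a measure) \<Rightarrow> (nat \<Rightarrow> 'a \<Rightarrow> real) \<Rightarrow> bool" where
  "bounded_in_probability M R \<longleftrightarrow>
     (\<forall>n\<ge>1. R n \<in> borel_measurable (M n)) \<and>
     (\<forall>\<epsilon>>0. \<exists>K. \<forall>n\<ge>1. measure (M n) {\<omega> \<in> space (M n). \<bar>R n \<omega>\<bar> > K} < \<epsilon>)"

end

theory Submission
  imports Defs
begin

text \<open>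
  Write \<open>\<sigma>\<^sub>e\<^sup>2 = (\<sigma>\<^sub>1\<^sup>2 + \<sigma>\<^sub>2\<^sup>2) / 2\<close> and tilt all Gaussians by the constant
  \<open>\<theta> = sqrt (2 * ln 2) / \<sigma>\<^sub>e\<close>, for which \<open>\<theta>\<^sup>2 * \<sigma>\<^sub>e\<^sup>2 / 2 = ln 2\<close>: under the tilted law a particle at time
  \<open>n\<close> sits near the asserted centering, and its density there, times \<open>2 ^ n\<close>, is of order one. The upper
  bound is the first moment. For the lower bound we count the particles that end in a unit interval at
  the centering and whose path stays, with linearly growing slack, below the tilted line at the times of
  the first phase and above it, measured backwards from the end, in the second phase. Because
  \<open>\<sigma>\<^sub>1\<^sup>2 < \<sigma>\<^sub>e\<^sup>2 < \<sigma>\<^sub>2\<^sup>2\<close>, the contribution of a pair of such particles to the second moment decays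
  exponentially in the distance of the splitting time to the two endpoints, so no logarithmic barrier is
  needed. Only displacements after time \<open>k\<close> are counted, which makes pairs splitting before \<open>k\<close>
  independent; Chebyshev's inequality then bounds the probability that no particle is counted by a constant
  times \<open>exp (- \<theta>\<^sup>2 * \<sigma>\<^sub>1\<^sup>2 * k / 2)\<close>, uniformly in \<open>n\<close>, and the positions at time \<open>k\<close> are tight.
\<close>

section \<open>Gaussian estimates and the second moment method\<close>

text \<open>Completing the square. This exponential change of measure underlies every Gaussian
  estimate below; it moves the mean to \<open>\<theta> * \<tau>\<^sup>2\<close> and keeps the
  variance.\<close>

lemma normal_density_tilt:
  assumes "\<tau> > 0"
  shows "normal_density 0 \<tau> u = exp (\<theta>\<^sup>2 * \<tau>\<^sup>2 / 2 - \<theta> * u) * normal_density (\<theta> * \<tau>\<^sup>2) \<tau> u"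
proof -
  have "- (u - 0)\<^sup>2 / (2 * \<tau>\<^sup>2) = (\<theta>\<^sup>2 * \<tau>\<^sup>2 / 2 - \<theta> * u) + (- (u - \<theta> * \<tau>\<^sup>2)\<^sup>2 / (2 * \<tau>\<^sup>2))"
    using assms by (simp add: field_simps power2_eq_square)
  then show ?thesis by (simp add: normal_density_def exp_add [symmetric])
qed

lemma normal_density_le_inverse:
  assumes "\<tau> > 0"
  shows "normal_density \<mu> \<tau> u \<le> 1 / \<tau>"
proof -
  have "1 * \<tau>\<^sup>2 \<le> 2 * pi * \<tau>\<^sup>2"
    using pi_gt3 by (intro mult_right_mono) auto
  then have "\<tau> \<le> sqrt (2 * pi * \<tau>\<^sup>2)" by (intro real_le_rsqrt) simp
  then have "1 / sqrt (2 * pi * \<tau>\<^sup>2) \<le> 1 / \<tau>" using assms by (intro divide_left_mono) auto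
  moreover have "exp (- (u - \<mu>)\<^sup>2 / (2 * \<tau>\<^sup>2)) \<le> 1" by simp
  ultimately have "1 / sqrt (2 * pi * \<tau>\<^sup>2) * exp (- (u - \<mu>)\<^sup>2 / (2 * \<tau>\<^sup>2)) \<le> 1 / \<tau> * 1"
    using assms by (intro mult_mono) auto
  then show ?thesis by (simp add: normal_density_def)
qed

lemma nn_integral_normal_density:
  assumes "\<tau> > 0"
  shows "(\<integral>\<^sup>+ x. ennreal (normal_density \<mu> \<tau> x) \<partial>lborel) = 1"
  using assms by (subst nn_integral_eq_integral) auto

context prob_space
begin

lemma distributed_prob_le:
  fixes X :: "'a \<Rightarrow> real"
  assumes "distributed M lborel X f" "A \<in> sets borel"
    and "(\<integral>\<^sup>+ x. f x * indicator A x \<partial>lborel) \<le> ennreal c" "c \<ge> 0"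
  shows "prob {\<omega> \<in> space M. X \<omega> \<in> A} \<le> c"
proof -
  have "{\<omega> \<in> space M. X \<omega> \<in> A} = X -` A \<inter> space M" by auto
  then have "emeasure M {\<omega> \<in> space M. X \<omega> \<in> A} \<le> ennreal c"
    using distributed_emeasure[OF assms(1), of A] assms by simp
  then show ?thesis using assms(4) by (simp add: emeasure_eq_measure)
qed

text \<open>Chernoff's bound: beyond \<open>t\<close> the tilting factor is at most its value at
  \<open>t\<close>, and the tilted density has mass one.\<close>

lemma normal_tail_le_exp:
  assumes X: "distributed M lborel X (normal_density 0 \<tau>)" and "\<tau> > 0" "\<theta> \<ge> 0"
  shows "prob {\<omega> \<in> space M. X \<omega> \<ge> t} \<le> exp (\<theta>\<^sup>2 * \<tau>\<^sup>2 / 2 - \<theta> * t)"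
proof -
  have "(\<integral>\<^sup>+ x. ennreal (normal_density 0 \<tau> x) * indicator {t..} x \<partial>lborel) \<le>
     (\<integral>\<^sup>+ x. ennreal (exp (\<theta>\<^sup>2 * \<tau>\<^sup>2 / 2 - \<theta> * t)) * ennreal (normal_density (\<theta> * \<tau>\<^sup>2) \<tau> x) \<partial>lborel)"
  proof (rule nn_integral_mono)
    fix x
    have "x \<ge> t \<Longrightarrow> normal_density 0 \<tau> x \<le> exp (\<theta>\<^sup>2 * \<tau>\<^sup>2 / 2 - \<theta> * t) * normal_density (\<theta> * \<tau>\<^sup>2) \<tau> x"
      unfolding normal_density_tilt[OF assms(2), of x \<theta>] using assms(3)
      by (intro mult_right_mono) (auto intro: mult_left_mono)
    then show "ennreal (normal_density 0 \<tau> x) * indicator {t..} x \<le>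
        ennreal (exp (\<theta>\<^sup>2 * \<tau>\<^sup>2 / 2 - \<theta> * t)) * ennreal (normal_density (\<theta> * \<tau>\<^sup>2) \<tau> x)"
      by (auto simp: indicator_def ennreal_mult[symmetric] intro: ennreal_leI)
  qed
  also have "\<dots> = ennreal (exp (\<theta>\<^sup>2 * \<tau>\<^sup>2 / 2 - \<theta> * t))"
    using assms by (simp add: nn_integral_cmult nn_integral_normal_density)
  finally show ?thesis
    using distributed_prob_le[OF X, of "{t..}"] by simp
qed

text \<open>Bounding the tilted density by \<open>1 / \<tau>\<close> and integrating the exponential
  factor gains \<open>1 / (\<theta> * \<tau>)\<close> over Chernoff's bound. For
  \<open>\<tau>\<close> of order sqrt n this cancels the factor sqrt n that the logarithmic term of
  the centering produces.\<close>

lemma normal_tail_le_exp_div: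
  assumes X: "distributed M lborel X (normal_density 0 \<tau>)" and "\<tau> > 0" "\<theta> > 0"
  shows "prob {\<omega> \<in> space M. X \<omega> \<ge> t} \<le> exp (\<theta>\<^sup>2 * \<tau>\<^sup>2 / 2 - \<theta> * t) / (\<theta> * \<tau>)"
proof -
  let ?f = "\<lambda>x. exp (\<theta>\<^sup>2 * \<tau>\<^sup>2 / 2 - \<theta> * x) / \<tau>"
  let ?F = "\<lambda>x. - exp (\<theta>\<^sup>2 * \<tau>\<^sup>2 / 2 - \<theta> * x) / (\<theta> * \<tau>)"
  have "(\<integral>\<^sup>+ x. ennreal (normal_density 0 \<tau> x) * indicator {t..} x \<partial>lborel) \<le>
     (\<integral>\<^sup>+ x. ennreal (?f x) * indicator {t..} x \<partial>lborel)"
  proof (rule nn_integral_mono, rule mult_right_mono, rule ennreal_leI)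
    fix x
    show "normal_density 0 \<tau> x \<le> ?f x"
      unfolding normal_density_tilt[OF assms(2), of x \<theta>]
      using mult_left_mono[OF normal_density_le_inverse[OF assms(2), of "\<theta> * \<tau>\<^sup>2" x]] by auto
  qed auto
  also have "\<dots> = ennreal (0 - ?F t)"
  proof (rule nn_integral_FTC_atLeast)
    show "(?F has_real_derivative ?f x) (at x)" for x
      using assms by (auto intro!: derivative_eq_intros simp: field_simps)
    have "filterlim (\<lambda>x. - (\<theta> * x)) at_bot at_top"
      using assms by (intro filterlim_uminus_at_bot_at_top[THEN filterlim_compose]
         filterlim_tendsto_pos_mult_at_top[OF tendsto_const] filterlim_ident)
    then have "((\<lambda>x. - exp (\<theta>\<^sup>2 * \<tau>\<^sup>2 / 2) / (\<theta> * \<tau>) * exp (- (\<theta> * x))) \<longlongrightarrow>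
        - exp (\<theta>\<^sup>2 * \<tau>\<^sup>2 / 2) / (\<theta> * \<tau>) * 0) at_top"
      by (intro tendsto_mult_left filterlim_compose[OF exp_at_bot])
    moreover have "(\<lambda>x. - exp (\<theta>\<^sup>2 * \<tau>\<^sup>2 / 2) / (\<theta> * \<tau>) * exp (- (\<theta> * x))) = ?F"
      by (simp add: diff_conv_add_uminus exp_add del: add_uminus_conv_diff)
    ultimately show "(?F \<longlongrightarrow> 0) at_top" by simp
  qed (use assms in auto)
  finally show ?thesis
    using distributed_prob_le[OF X, of "{t..}"] assms by simp
qed

lemma normal_unit_interval_le:
  assumes X: "distributed M lborel X (normal_density 0 \<tau>)" and "\<tau> > 0" "\<theta> \<ge> 0"
  shows "prob {\<omega> \<in> space M. X \<omega> \<in> {t..t+1}} \<le> exp (\<theta>\<^sup>2 * \<tau>\<^sup>2 / 2 - \<theta> * t) / \<tau>"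
proof -
  have "(\<integral>\<^sup>+ x. ennreal (normal_density 0 \<tau> x) * indicator {t..t+1} x \<partial>lborel) \<le>
     (\<integral>\<^sup>+ x. ennreal (exp (\<theta>\<^sup>2 * \<tau>\<^sup>2 / 2 - \<theta> * t) / \<tau>) * indicator {t..t+1} x \<partial>lborel)"
  proof (rule nn_integral_mono)
    fix x
    have "x \<ge> t \<Longrightarrow> normal_density 0 \<tau> x \<le> exp (\<theta>\<^sup>2 * \<tau>\<^sup>2 / 2 - \<theta> * t) * (1 / \<tau>)"
      unfolding normal_density_tilt[OF assms(2), of x \<theta>] using assms
      by (intro mult_mono normal_density_le_inverse) (auto intro: mult_left_mono)
    then show "ennreal (normal_density 0 \<tau> x) * indicator {t..t+1} x \<le>
        ennreal (exp (\<theta>\<^sup>2 * \<tau>\<^sup>2 / 2 - \<theta> * t) / \<tau>) * indicator {t..t+1} x"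
      by (auto simp: indicator_def intro: ennreal_leI)
  qed
  also have "\<dots> = ennreal (exp (\<theta>\<^sup>2 * \<tau>\<^sup>2 / 2 - \<theta> * t) / \<tau>)"
    by (simp add: nn_integral_cmult_indicator)
  finally show ?thesis
    using distributed_prob_le[OF X, of "{t..t+1}"] assms by simp
qed

text \<open>\<open>D\<close> dominates the distance from the tilted mean to every point of the
  interval, which bounds the tilted density from below; the tilting factor is smallest at the right
  endpoint.\<close>

lemma normal_unit_interval_ge:
  assumes X: "distributed M lborel X (normal_density 0 \<tau>)" and "\<tau> > 0" "\<theta> \<ge> 0"
    and D: "\<bar>t - \<theta> * \<tau>\<^sup>2\<bar> + 1 \<le> D"
  shows "exp (\<theta>\<^sup>2 * \<tau>\<^sup>2 / 2 - \<theta> * (t + 1) - D\<^sup>2 / (2 * \<tau>\<^sup>2)) / (sqrt (2 * pi) * \<tau>)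
    \<le> prob {\<omega> \<in> space M. X \<omega> \<in> {t..t+1}}"
proof -
  let ?c = "exp (\<theta>\<^sup>2 * \<tau>\<^sup>2 / 2 - \<theta> * (t + 1) - D\<^sup>2 / (2 * \<tau>\<^sup>2)) / (sqrt (2 * pi) * \<tau>)"
  have "ennreal ?c = (\<integral>\<^sup>+ x. ennreal ?c * indicator {t..t+1} x \<partial>lborel)"
    by (simp add: nn_integral_cmult_indicator)
  also have "\<dots> \<le> (\<integral>\<^sup>+ x. ennreal (normal_density 0 \<tau> x) * indicator {t..t+1} x \<partial>lborel)"
  proof (rule nn_integral_mono)
    fix x
    have "?c \<le> normal_density 0 \<tau> x" if x: "t \<le> x" "x \<le> t + 1"
    proof -
      have "\<bar>x - \<theta> * \<tau>\<^sup>2\<bar> \<le> D" using D x by linarith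
      then have "(x - \<theta> * \<tau>\<^sup>2)\<^sup>2 \<le> D\<^sup>2" by (metis abs_ge_zero abs_le_square_iff abs_of_nonneg order_trans)
      then have "- D\<^sup>2 / (2 * \<tau>\<^sup>2) \<le> - (x - \<theta> * \<tau>\<^sup>2)\<^sup>2 / (2 * \<tau>\<^sup>2)"
        by (intro divide_right_mono) auto
      moreover have "\<theta> * x \<le> \<theta> * (t + 1)" using x assms by (intro mult_left_mono) auto
      ultimately have "exp (\<theta>\<^sup>2 * \<tau>\<^sup>2 / 2 - \<theta> * (t + 1) - D\<^sup>2 / (2 * \<tau>\<^sup>2))
         \<le> exp (\<theta>\<^sup>2 * \<tau>\<^sup>2 / 2 - \<theta> * x + - (x - \<theta> * \<tau>\<^sup>2)\<^sup>2 / (2 * \<tau>\<^sup>2))"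
        by simp
      then have "?c \<le> exp (\<theta>\<^sup>2 * \<tau>\<^sup>2 / 2 - \<theta> * x + - (x - \<theta> * \<tau>\<^sup>2)\<^sup>2 / (2 * \<tau>\<^sup>2)) / (sqrt (2 * pi) * \<tau>)"
        using assms by (intro divide_right_mono) auto
      also have "\<dots> = normal_density 0 \<tau> x"
        unfolding normal_density_tilt[OF assms(2), of x \<theta>] using assms
        by (simp add: normal_density_def exp_add[symmetric] real_sqrt_mult)
      finally show ?thesis .
    qed
    then show "ennreal ?c * indicator {t..t+1} x \<le> ennreal (normal_density 0 \<tau> x) * indicator {t..t+1} x"
      by (auto simp: indicator_def intro: ennreal_leI)
  qed
  also have "\<dots> = emeasure M (X -` {t..t+1} \<inter> space M)"
    using distributed_emeasure[OF X, of "{t..t+1}"] by simp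
  also have "X -` {t..t+1} \<inter> space M = {\<omega> \<in> space M. X \<omega> \<in> {t..t+1}}" by auto
  finally show ?thesis using assms(2) by (simp add: emeasure_eq_measure)
qed

text \<open>Two tilts at once: \<open>\<theta>\<close> handles the end point of the sum,
  \<open>\<mu>\<close> the deviation of \<open>X\<close> from its tilted mean. The factor
  \<open>1 / \<rho>\<close> comes from the density of \<open>Y\<close> alone. The sign of
  \<open>\<mu>\<close> is free, so upward and downward deviations are both covered.\<close>

lemma normal_sum_unit_interval_le:
  assumes X: "distributed M lborel X (normal_density 0 \<tau>)" and "\<tau> > 0"
    and Y: "distributed M lborel Y (normal_density 0 \<rho>)" and "\<rho> > 0"
    and ind: "indep_var borel X borel Y" and "\<theta> \<ge> 0"
  shows "prob {\<omega> \<in> space M. X \<omega> + Y \<omega> \<in> {t..t+1} \<and> \<mu> * (X \<omega> - \<theta> * \<tau>\<^sup>2) \<ge> c}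
    \<le> exp (\<theta>\<^sup>2 * (\<tau>\<^sup>2 + \<rho>\<^sup>2) / 2 - \<theta> * t) / \<rho> * exp (\<mu>\<^sup>2 * \<tau>\<^sup>2 / 2 - c)"
proof -
  define A where "A = {p :: real \<times> real. fst p + snd p \<in> {t..t+1} \<and> \<mu> * (fst p - \<theta> * \<tau>\<^sup>2) \<ge> c}"
  define C where "C = exp (\<theta>\<^sup>2 * \<rho>\<^sup>2 / 2 - \<theta> * t) / \<rho>"
  have [measurable]: "random_variable borel X" "random_variable borel Y"
    using X Y by (auto dest: distributed_measurable)
  interpret Y: prob_space "distr M borel Y" by (rule prob_space_distr) simp
  have "{p \<in> space (borel \<Otimes>\<^sub>M borel). t \<le> fst p + snd p \<and> fst p + snd p \<le> t + 1 \<and> c \<le> \<mu> * (fst p - \<theta> * \<tau>\<^sup>2)}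
      \<in> sets (borel \<Otimes>\<^sub>M borel :: (real \<times> real) measure)"
    by measurable
  then have A: "A \<in> sets (borel \<Otimes>\<^sub>M borel)"
    by (simp only: A_def space_pair_measure atLeastAtMost_iff space_borel UNIV_Times_UNIV UNIV_I simp_thms conj_assoc)
  have "emeasure M {\<omega> \<in> space M. X \<omega> + Y \<omega> \<in> {t..t+1} \<and> \<mu> * (X \<omega> - \<theta> * \<tau>\<^sup>2) \<ge> c}
     = emeasure (distr M (borel \<Otimes>\<^sub>M borel) (\<lambda>\<omega>. (X \<omega>, Y \<omega>))) A"
    using A by (subst emeasure_distr) (auto intro!: arg_cong[where f="emeasure M"] simp: A_def)
  also have "\<dots> = emeasure (distr M borel X \<Otimes>\<^sub>M distr M borel Y) A"
    using ind by (simp add: indep_var_distribution_eq)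
  also have "\<dots> = (\<integral>\<^sup>+ x. emeasure (distr M borel Y) (Pair x -` A) \<partial>distr M borel X)"
    using A by (subst Y.emeasure_pair_measure_alt) auto
  \<comment> \<open>For fixed \<open>x\<close> the sum condition confines \<open>Y\<close> to a unit
    interval. The condition on \<open>x\<close> is traded for an exponential factor that is at least
    one wherever the condition holds.\<close>
  also have "\<dots> \<le> (\<integral>\<^sup>+ x. ennreal (C * exp (\<theta> * x + (\<mu> * (x - \<theta> * \<tau>\<^sup>2) - c))) \<partial>distr M borel X)"
  proof (rule nn_integral_mono)
    fix x
    show "emeasure (distr M borel Y) (Pair x -` A) \<le> ennreal (C * exp (\<theta> * x + (\<mu> * (x - \<theta> * \<tau>\<^sup>2) - c)))"
    proof (cases "\<mu> * (x - \<theta> * \<tau>\<^sup>2) \<ge> c")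
      case False
      then have "Pair x -` A = {}" by (auto simp: A_def)
      then show ?thesis by simp
    next
      case True
      then have "Pair x -` A = {t - x .. t - x + 1}" by (auto simp: A_def)
      then have "emeasure (distr M borel Y) (Pair x -` A) = prob {\<omega> \<in> space M. Y \<omega> \<in> {t - x .. t - x + 1}}"
        by (simp add: emeasure_distr emeasure_eq_measure vimage_def Int_def conj_commute)
      moreover have "prob {\<omega> \<in> space M. Y \<omega> \<in> {t - x .. t - x + 1}}
          \<le> exp (\<theta>\<^sup>2 * \<rho>\<^sup>2 / 2 - \<theta> * (t - x)) / \<rho>"
        by (rule normal_unit_interval_le) (use assms in auto)
      moreover have "exp (\<theta>\<^sup>2 * \<rho>\<^sup>2 / 2 - \<theta> * (t - x)) / \<rho> = C * exp (\<theta> * x)"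
        by (simp add: C_def exp_add[symmetric] algebra_simps)
      moreover have "C * exp (\<theta> * x) \<le> C * exp (\<theta> * x + (\<mu> * (x - \<theta> * \<tau>\<^sup>2) - c))"
        using True assms by (intro mult_left_mono) (auto simp: C_def)
      ultimately show ?thesis by (simp add: ennreal_leI)
    qed
  qed
  also have "\<dots> = (\<integral>\<^sup>+ x. ennreal (normal_density 0 \<tau> x) * ennreal (C * exp (\<theta> * x + (\<mu> * (x - \<theta> * \<tau>\<^sup>2) - c))) \<partial>lborel)"
  proof -
    have "distr M borel X = distr M lborel X" by (rule distr_cong) auto
    also have "\<dots> = density lborel (\<lambda>x. ennreal (normal_density 0 \<tau> x))"
      using X by (rule distributed_distr_eq_density)
    finally show ?thesis by (simp add: nn_integral_density)
  qed
  also have "\<dots> = (\<integral>\<^sup>+ x. ennreal (C * exp ((\<theta>\<^sup>2 + \<mu>\<^sup>2) * \<tau>\<^sup>2 / 2 - c)) *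
      ennreal (normal_density ((\<theta> + \<mu>) * \<tau>\<^sup>2) \<tau> x) \<partial>lborel)"
  proof (rule nn_integral_cong)
    fix x
    \<comment> \<open>Tilting \<open>X\<close> by \<open>\<theta> + \<mu>\<close> removes
      \<open>x\<close> from the exponent, so that only the mass of a normal density remains to be
      integrated.\<close>
    have "(\<theta> + \<mu>)\<^sup>2 * \<tau>\<^sup>2 / 2 - (\<theta> + \<mu>) * x + (\<theta> * x + (\<mu> * (x - \<theta> * \<tau>\<^sup>2) - c))
        = (\<theta>\<^sup>2 + \<mu>\<^sup>2) * \<tau>\<^sup>2 / 2 - c"
      by (simp add: power2_eq_square algebra_simps add_divide_distrib)
    then have "exp ((\<theta> + \<mu>)\<^sup>2 * \<tau>\<^sup>2 / 2 - (\<theta> + \<mu>) * x) * exp (\<theta> * x + (\<mu> * (x - \<theta> * \<tau>\<^sup>2) - c))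
        = exp ((\<theta>\<^sup>2 + \<mu>\<^sup>2) * \<tau>\<^sup>2 / 2 - c)"
      by (simp only: exp_add[symmetric])
    from this[symmetric] have "normal_density 0 \<tau> x * (C * exp (\<theta> * x + (\<mu> * (x - \<theta> * \<tau>\<^sup>2) - c)))
      = C * exp ((\<theta>\<^sup>2 + \<mu>\<^sup>2) * \<tau>\<^sup>2 / 2 - c) * normal_density ((\<theta> + \<mu>) * \<tau>\<^sup>2) \<tau> x"
      unfolding normal_density_tilt[OF assms(2), of x "\<theta> + \<mu>"]
      by (simp only: mult_ac)
    then show "ennreal (normal_density 0 \<tau> x) * ennreal (C * exp (\<theta> * x + (\<mu> * (x - \<theta> * \<tau>\<^sup>2) - c)))
      = ennreal (C * exp ((\<theta>\<^sup>2 + \<mu>\<^sup>2) * \<tau>\<^sup>2 / 2 - c)) * ennreal (normal_density ((\<theta> + \<mu>) * \<tau>\<^sup>2) \<tau> x)"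
      using assms by (simp add: ennreal_mult[symmetric] C_def)
  qed
  also have "\<dots> = ennreal (C * exp ((\<theta>\<^sup>2 + \<mu>\<^sup>2) * \<tau>\<^sup>2 / 2 - c))"
    using assms by (simp add: nn_integral_cmult nn_integral_normal_density)
  also have "C * exp ((\<theta>\<^sup>2 + \<mu>\<^sup>2) * \<tau>\<^sup>2 / 2 - c) =
      exp (\<theta>\<^sup>2 * (\<tau>\<^sup>2 + \<rho>\<^sup>2) / 2 - \<theta> * t) / \<rho> * exp (\<mu>\<^sup>2 * \<tau>\<^sup>2 / 2 - c)"
    by (simp add: C_def exp_add[symmetric] field_simps)
  finally show ?thesis using assms(4) by (simp add: emeasure_eq_measure)
qed

text \<open>Chebyshev's inequality for the number of the events \<open>E i\<close> that occur; \<open>R\<close> contains the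
  pairs of events that may be positively correlated.\<close>

lemma second_moment_none_le:
  assumes "finite I" and E: "\<And>i. i \<in> I \<Longrightarrow> E i \<in> events"
    and ind: "\<And>i j. i \<in> I \<Longrightarrow> j \<in> I \<Longrightarrow> (i, j) \<notin> R \<Longrightarrow> prob (E i \<inter> E j) \<le> prob (E i) * prob (E j)"
    and pos: "0 < (\<Sum>i\<in>I. prob (E i))"
  shows "prob (space M - (\<Union>i\<in>I. E i)) \<le>
    (\<Sum>i\<in>I. \<Sum>j\<in>I. if (i, j) \<in> R then prob (E i \<inter> E j) else 0) / (\<Sum>i\<in>I. prob (E i))\<^sup>2"
proof -
  define N where "N \<omega> = (\<Sum>i\<in>I. indicator (E i) \<omega> :: real)" for \<omega>
  define m where "m = (\<Sum>i\<in>I. prob (E i))"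
  have [measurable]: "N \<in> borel_measurable M"
    unfolding N_def using E by measurable
  have N2: "(N \<omega>)\<^sup>2 = (\<Sum>i\<in>I. \<Sum>j\<in>I. indicator (E i \<inter> E j) \<omega>)" for \<omega>
    by (simp add: N_def power2_eq_square sum_product indicator_inter_arith)
  have int2: "integrable M (\<lambda>\<omega>. (N \<omega>)\<^sup>2)"
    unfolding N2 using E by (intro Bochner_Integration.integrable_sum integrable_real_indicator)
      (auto simp: less_top[symmetric])
  have EN: "expectation N = m"
    unfolding N_def m_def using E
    by (subst Bochner_Integration.integral_sum) (auto intro!: integrable_real_indicator sum.cong simp: less_top[symmetric])
  have EN2: "expectation (\<lambda>\<omega>. (N \<omega>)\<^sup>2) = (\<Sum>i\<in>I. \<Sum>j\<in>I. prob (E i \<inter> E j))"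
    unfolding N2 using E
    by (simp add: Bochner_Integration.integral_sum integrable_real_indicator less_top[symmetric]
       Bochner_Integration.integrable_sum sets.Int cong: sum.cong)
  have "variance N = expectation (\<lambda>\<omega>. (N \<omega>)\<^sup>2) - m\<^sup>2"
    using int2 square_integrable_imp_integrable[of N] EN by (subst variance_eq) auto
  also have "\<dots> = (\<Sum>i\<in>I. \<Sum>j\<in>I. prob (E i \<inter> E j) - prob (E i) * prob (E j))"
    unfolding EN2 m_def by (simp add: power2_eq_square sum_product sum_subtractf)
  \<comment> \<open>Outside \<open>R\<close> the covariance is nonpositive by \<open>ind\<close>;
    inside \<open>R\<close> the subtracted product is dropped.\<close>
  also have "\<dots> \<le> (\<Sum>i\<in>I. \<Sum>j\<in>I. if (i, j) \<in> R then prob (E i \<inter> E j) else 0)"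
    using ind by (intro sum_mono) auto
  finally have var: "variance N \<le> (\<Sum>i\<in>I. \<Sum>j\<in>I. if (i, j) \<in> R then prob (E i \<inter> E j) else 0)" .
  have "prob (space M - (\<Union>i\<in>I. E i)) \<le> prob {\<omega> \<in> space M. m \<le> \<bar>N \<omega> - expectation N\<bar>}"
  proof (rule finite_measure_mono)
    show "space M - (\<Union>i\<in>I. E i) \<subseteq> {\<omega> \<in> space M. m \<le> \<bar>N \<omega> - expectation N\<bar>}"
      using EN by (auto simp: N_def)
  qed measurable
  also have "\<dots> \<le> variance N / m\<^sup>2"
    using int2 pos by (intro Chebyshev_inequality) (auto simp: m_def)
  also have "\<dots> \<le> (\<Sum>i\<in>I. \<Sum>j\<in>I. if (i, j) \<in> R then prob (E i \<inter> E j) else 0) / m\<^sup>2"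
    using var by (intro divide_right_mono) auto
  finally show ?thesis by (simp add: m_def)
qed

text \<open>Continuity from above along events that decrease to the empty set. It serves the
  finitely many small \<open>n\<close> that the barrier argument does not reach.\<close>

lemma exists_tail_bound:
  fixes R :: "'a \<Rightarrow> real"
  assumes [measurable]: "R \<in> borel_measurable M" and "\<epsilon> > 0"
  shows "\<exists>K\<ge>0. prob {\<omega> \<in> space M. \<bar>R \<omega>\<bar> > K} < \<epsilon>"
proof -
  have "(\<lambda>i. prob {\<omega> \<in> space M. \<bar>R \<omega>\<bar> > real i}) \<longlonglongrightarrow> prob (\<Inter>i. {\<omega> \<in> space M. \<bar>R \<omega>\<bar> > real i})"
    by (rule finite_Lim_measure_decseq) (auto simp: decseq_def)
  moreover have "(\<Inter>i. {\<omega> \<in> space M. \<bar>R \<omega>\<bar> > real i}) = {}"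
    by (auto simp: not_less) (metis reals_Archimedean2 less_asym)
  ultimately have "(\<lambda>i. prob {\<omega> \<in> space M. \<bar>R \<omega>\<bar> > real i}) \<longlonglongrightarrow> 0" by simp
  then have "\<forall>\<^sub>F i in sequentially. prob {\<omega> \<in> space M. \<bar>R \<omega>\<bar> > real i} < \<epsilon>"
    using assms(2) by (rule order_tendstoD)
  then obtain i where "prob {\<omega> \<in> space M. \<bar>R \<omega>\<bar> > real i} < \<epsilon>"
    by (auto simp: eventually_sequentially)
  then show ?thesis by (intro exI[of _ "real i"]) simp
qed

end

section \<open>Ancestral lines and variance profile\<close>

text \<open>The interval is half-open because a word of length \<open>j\<close> indexes the
  increment from time \<open>j - 1\<close> to \<open>j\<close>; summing increments over this set
  gives the displacement between times \<open>s\<close> and \<open>t\<close>. Working with sets of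
  words turns independence of displacements into disjointness of sets.\<close>

definition ancestry :: "nat \<Rightarrow> nat \<Rightarrow> bool list \<Rightarrow> bool list set" where
  "ancestry s t v = (\<lambda>j. take j v) ` {s<..t}"

lemma finite_ancestry [simp]: "finite (ancestry s t v)"
  by (simp add: ancestry_def)

lemma ancestry_subset: "s' \<le> s \<Longrightarrow> t \<le> t' \<Longrightarrow> ancestry s t v \<subseteq> ancestry s' t' v"
  by (auto simp: ancestry_def)

lemma ancestry_subset_particles:
  "t \<le> length v \<Longrightarrow> length v \<le> n \<Longrightarrow> ancestry s t v \<subseteq> (\<Union>k\<in>{1..n}. particles k)"
  by (auto simp: ancestry_def particles_def)

lemma in_ancestry_iff:
  assumes "t \<le> length v"
  shows "u \<in> ancestry s t v \<longleftrightarrow> u = take (length u) v \<and> s < length u \<and> length u \<le> t"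
proof
  assume "u \<in> ancestry s t v"
  then obtain j where j: "u = take j v" "j \<in> {s<..t}" unfolding ancestry_def by (rule imageE)
  then have "length u = j" using assms by simp
  with j show "u = take (length u) v \<and> s < length u \<and> length u \<le> t" by simp
next
  assume "u = take (length u) v \<and> s < length u \<and> length u \<le> t"
  then show "u \<in> ancestry s t v" unfolding ancestry_def by (intro image_eqI[of _ _ "length u"]) auto
qed

lemma ancestry_inter_ancestry_eq_empty: "s \<le> t \<Longrightarrow> t \<le> length v \<Longrightarrow> ancestry r s v \<inter> ancestry s t v = {}"
  by (auto simp: in_ancestry_iff)

lemma sum_ancestry:
  assumes "t \<le> length v"
  shows "(\<Sum>u\<in>ancestry s t v. f u) = (\<Sum>j\<in>{s<..t}. f (take j v))"
proof -
  have "inj_on (\<lambda>j. take j v) {s<..t}"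
  proof (rule inj_onI)
    fix i j assume "i \<in> {s<..t}" "j \<in> {s<..t}" "take i v = take j v"
    then show "i = j" using assms by (metis greaterThanAtMost_iff length_take min.absorb2 order_trans)
  qed
  then show ?thesis by (simp add: ancestry_def sum.reindex)
qed

text \<open>A common word would be longer than \<open>s\<close> and hence determine the same prefix
  of length \<open>Suc s\<close> in both particles. The line of \<open>v\<close> may start at any
  earlier time \<open>k\<close>, even before the split.\<close>

lemma ancestry_disjoint:
  assumes "length v = n" "length w = n" "take (Suc s) v \<noteq> take (Suc s) w"
    and "s \<le> s'"
  shows "ancestry k n v \<inter> ancestry s' n w = {}"
proof -
  have "False" if u: "u \<in> ancestry k n v" "u \<in> ancestry s' n w" for u
  proof -
    have v: "u = take (length u) v" and w: "u = take (length u) w" "s' < length u"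
      using u assms by (simp_all add: in_ancestry_iff)
    then have s: "Suc s \<le> length u" using assms by simp
    have "take (Suc s) v = take (Suc s) (take (length u) v)" using s by (simp add: min_def)
    also have "\<dots> = take (Suc s) (take (length u) w)" using v w(1) by simp
    also have "\<dots> = take (Suc s) w" using s by (simp add: min_def)
    finally show False using assms(3) by simp
  qed
  then show ?thesis by blast
qed

lemma finite_particles [simp]: "finite (particles k)"
  and card_particles: "card (particles k) = 2 ^ k"
  using finite_lists_length_eq[of "UNIV :: bool set" k] card_lists_length_eq[of "UNIV :: bool set" k]
  by (simp_all add: particles_def)

lemma card_particles_prefix_le:
  assumes "length p = s"
  shows "card {w \<in> particles n. take s w = p} \<le> 2 ^ (n - s)"
proof -
  have "{w \<in> particles n. take s w = p} \<subseteq> (\<lambda>u. p @ u) ` particles (n - s)"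
  proof
    fix w assume w: "w \<in> {w \<in> particles n. take s w = p}"
    then have "w = p @ drop s w" using append_take_drop_id[of s w] by simp
    moreover have "drop s w \<in> particles (n - s)" using w by (auto simp: particles_def)
    ultimately show "w \<in> (\<lambda>u. p @ u) ` particles (n - s)" by blast
  qed
  then have "card {w \<in> particles n. take s w = p} \<le> card (particles (n - s))"
    by (meson finite_imageI finite_particles card_mono card_image_le order_trans)
  then show ?thesis by (simp add: card_particles)
qed

text \<open>Downward induction from \<open>n\<close> finds the last time at which the two lines
  agree. The value \<open>s = n\<close> encodes \<open>v = w\<close>, so the diagonal of the second
  moment needs no separate treatment.\<close>

lemma exists_split_level:
  assumes "length v = n" "length w = n" "take k v = take k w" "k \<le> n"
  shows "\<exists>s\<in>{k..n}. take s v = take s w \<and> (s < n \<longrightarrow> take (Suc s) v \<noteq> take (Suc s) w)"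
  using assms(4,3)
proof (induction rule: inc_induct)
  case base
  then show ?case by auto
next
  case (step k)
  then show ?case
    by (cases "take (Suc k) v = take (Suc k) w") (auto intro: Suc_leD)
qed

text \<open>The injection \<open>f\<close> allows exponents that count up from the time
  \<open>k\<close> as well as down to the time \<open>n\<close>.\<close>

lemma sum_geometric_le:
  fixes q :: real
  assumes "0 \<le> q" "q < 1" "finite A" "inj_on f A"
  shows "(\<Sum>i\<in>A. q ^ f i) \<le> 1 / (1 - q)"
proof -
  have "(\<Sum>i\<in>A. q ^ f i) = (\<Sum>i\<in>f ` A. q ^ i)" using assms by (simp add: sum.reindex)
  also have "\<dots> \<le> (\<Sum>i. q ^ i)" using assms by (intro sum_le_suminf summable_geometric) auto
  also have "\<dots> = 1 / (1 - q)" using assms by (intro suminf_geometric) auto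
  finally show ?thesis .
qed

section \<open>Variance profile and centering\<close>

locale increasing_variances =
  fixes \<sigma>\<^sub>1 \<sigma>\<^sub>2 :: real
  assumes pos: "\<sigma>\<^sub>1 > 0" "\<sigma>\<^sub>2 > 0" and less: "\<sigma>\<^sub>1\<^sup>2 < \<sigma>\<^sub>2\<^sup>2"
begin

text \<open>The number of steps with standard deviation \<open>\<sigma>\<^sub>1\<close>: n/2 rounded
  up, since for odd \<open>n\<close> the middle step starts before n/2.\<close>

definition half :: "nat \<Rightarrow> nat" where "half n = (n + 1) div 2"

text \<open>The variance of a position at time \<open>s\<close>; the truncated subtraction makes the
  second term vanish in the first phase.\<close>

definition var_at :: "nat \<Rightarrow> nat \<Rightarrow> real" where
  "var_at n s = \<sigma>\<^sub>1\<^sup>2 * real (min s (half n)) + \<sigma>\<^sub>2\<^sup>2 * real (s - half n)"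

definition eff :: real where "eff = (\<sigma>\<^sub>1\<^sup>2 + \<sigma>\<^sub>2\<^sup>2) / 2"

definition tilt :: real where "tilt = sqrt (2 * ln 2 / eff)"

text \<open>The asserted centering, expressed through \<open>tilt\<close> so that exponents
  simplify; \<open>eff\<close> is the effective variance, not its root.
  \<open>center_formulas\<close> translates back.\<close>

definition center :: "nat \<Rightarrow> real" where "center n = tilt * eff * real n - ln (real n) / (2 * tilt)"

lemma eff_pos: "eff > 0" using pos by (auto simp: eff_def intro!: add_pos_pos)

lemma tilt_pos: "tilt > 0" using eff_pos by (simp add: tilt_def)

lemma tilt_sq: "tilt\<^sup>2 * eff = 2 * ln 2" using eff_pos by (simp add: tilt_def)

lemma less_half_iff: "real j < real n / 2 \<longleftrightarrow> j < half n"
proof -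
  have "real j < real n / 2 \<longleftrightarrow> real (2 * j) < real n" by auto
  also have "\<dots> \<longleftrightarrow> 2 * j < n" by (simp only: of_nat_less_iff)
  also have "\<dots> \<longleftrightarrow> j < half n" by (auto simp: half_def)
  finally show ?thesis .
qed

lemma var_at_Suc: "var_at n (Suc s) = var_at n s + (if real s < real n / 2 then \<sigma>\<^sub>1 else \<sigma>\<^sub>2)\<^sup>2"
  unfolding less_half_iff
  by (auto simp: var_at_def min_def algebra_simps Suc_diff_le not_less_eq_eq not_le)

lemma sum_var_at:
  assumes "s \<le> t"
  shows "(\<Sum>j\<in>{s<..t}. (if real (j - 1) < real n / 2 then \<sigma>\<^sub>1 else \<sigma>\<^sub>2)\<^sup>2) = var_at n t - var_at n s"
  using assms
proof (induction t rule: dec_induct)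
  case base
  then show ?case by simp
next
  case (step t)
  have "{s<..Suc t} = insert (Suc t) {s<..t}" using step(1) by auto
  then show ?case using step by (simp add: var_at_Suc)
qed

lemma var_at_first: "s \<le> half n \<Longrightarrow> var_at n s = \<sigma>\<^sub>1\<^sup>2 * real s"
  by (simp add: var_at_def)

lemma var_at_last:
  assumes "half n \<le> s" "s \<le> n"
  shows "var_at n n - var_at n s = \<sigma>\<^sub>2\<^sup>2 * real (n - s)"
proof -
  have "min n (half n) = half n" "min s (half n) = half n" using assms by auto
  moreover have "real (n - half n) - real (s - half n) = real (n - s)" using assms by simp
  ultimately show ?thesis
    by (simp add: var_at_def flip: right_diff_distrib)
qed

lemma var_at_bounds:
  assumes "s \<le> t"
  shows "\<sigma>\<^sub>1\<^sup>2 * real (t - s) \<le> var_at n t - var_at n s" "var_at n t - var_at n s \<le> \<sigma>\<^sub>2\<^sup>2 * real (t - s)"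
  using assms
proof (induction t rule: dec_induct)
  case base
  { case 1 then show ?case by simp }
  { case 2 then show ?case by simp }
next
  case (step t)
  have "real (Suc t - s) = real (t - s) + 1" using step(1) by simp
  then show "\<sigma>\<^sub>1\<^sup>2 * real (Suc t - s) \<le> var_at n (Suc t) - var_at n s"
    "var_at n (Suc t) - var_at n s \<le> \<sigma>\<^sub>2\<^sup>2 * real (Suc t - s)"
    using step less by (auto simp: var_at_Suc algebra_simps)
qed

text \<open>The difference of the two sides is
  \<open>\<sigma>\<^sub>2\<^sup>2 - \<sigma>\<^sub>1\<^sup>2\<close> times the rounding error of
  \<open>half n\<close>, which is 0 or 1/2 according to the parity of \<open>n\<close>.\<close>

lemma var_at_total:
  "var_at n n \<le> eff * real n" "eff * real n \<le> var_at n n + (\<sigma>\<^sub>2\<^sup>2 - \<sigma>\<^sub>1\<^sup>2) / 2"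
proof -
  have h: "half n \<le> n" by (cases n) (auto simp: half_def)
  have "eff * real n - var_at n n = (\<sigma>\<^sub>2\<^sup>2 - \<sigma>\<^sub>1\<^sup>2) * (real (half n) - real n / 2)"
    using h by (simp add: var_at_def eff_def min_def of_nat_diff algebra_simps add_divide_distrib diff_divide_distrib)
  moreover have "0 \<le> real (half n) - real n / 2" "real (half n) - real n / 2 \<le> 1 / 2"
    by (cases "even n"; auto simp: half_def elim!: evenE oddE)+
  ultimately show "var_at n n \<le> eff * real n" "eff * real n \<le> var_at n n + (\<sigma>\<^sub>2\<^sup>2 - \<sigma>\<^sub>1\<^sup>2) / 2"
    using less mult_nonneg_nonneg[of "\<sigma>\<^sub>2\<^sup>2 - \<sigma>\<^sub>1\<^sup>2" "real (half n) - real n / 2"]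
      mult_left_mono[of "real (half n) - real n / 2" "1 / 2" "\<sigma>\<^sub>2\<^sup>2 - \<sigma>\<^sub>1\<^sup>2"]
    by linarith+
qed

text \<open>With \<open>eff * real n\<close> in place of \<open>var_at n n\<close> equality would
  hold, by \<open>tilt_sq\<close>: the linear part of the centering yields 2^(-n) and the
  logarithmic part sqrt n. The constant in the lower bound pays for the rounding error of odd
  \<open>n\<close>.\<close>

lemma exp_center_bounds:
  assumes "n \<ge> 1"
  shows "exp (tilt\<^sup>2 * var_at n n / 2 - tilt * center n) \<le> sqrt n / 2 ^ n"
    and "exp (- tilt\<^sup>2 * (\<sigma>\<^sub>2\<^sup>2 - \<sigma>\<^sub>1\<^sup>2) / 4) * (sqrt n / 2 ^ n) \<le> exp (tilt\<^sup>2 * var_at n n / 2 - tilt * center n)"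
proof -
  have e: "tilt * center n = 2 * (real n * ln 2) - ln (real n) / 2"
  proof -
    have "tilt * center n = tilt\<^sup>2 * eff * real n - ln (real n) / 2"
      using tilt_pos by (simp add: center_def power2_eq_square right_diff_distrib)
    then show ?thesis unfolding tilt_sq by simp
  qed
  have "sqrt n / 2 ^ n = exp (ln (real n) / 2 - real n * ln 2)"
  proof -
    have "sqrt n = exp (ln (real n) / 2)" using assms by (simp add: powr_half_sqrt[symmetric] powr_def)
    moreover have "2 ^ n = exp (real n * ln 2)" by (simp add: exp_of_nat_mult)
    ultimately show ?thesis by (simp add: exp_diff)
  qed
  moreover have "tilt\<^sup>2 * var_at n n / 2 \<le> real n * ln 2"
  proof -
    have "tilt\<^sup>2 * var_at n n \<le> tilt\<^sup>2 * (eff * real n)"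
      by (intro mult_left_mono var_at_total) auto
    also have "\<dots> = 2 * ln 2 * real n" unfolding tilt_sq[symmetric] by simp
    finally show ?thesis by (simp add: mult_ac)
  qed
  moreover have "real n * ln 2 \<le> tilt\<^sup>2 * var_at n n / 2 + tilt\<^sup>2 * (\<sigma>\<^sub>2\<^sup>2 - \<sigma>\<^sub>1\<^sup>2) / 4"
  proof -
    have "tilt\<^sup>2 * (eff * real n) \<le> tilt\<^sup>2 * (var_at n n + (\<sigma>\<^sub>2\<^sup>2 - \<sigma>\<^sub>1\<^sup>2) / 2)"
      by (intro mult_left_mono var_at_total) auto
    also have "tilt\<^sup>2 * (eff * real n) = 2 * ln 2 * real n" unfolding tilt_sq[symmetric] by simp
    finally show ?thesis by (simp add: distrib_left mult_ac)
  qed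
  ultimately show "exp (tilt\<^sup>2 * var_at n n / 2 - tilt * center n) \<le> sqrt n / 2 ^ n"
    "exp (- tilt\<^sup>2 * (\<sigma>\<^sub>2\<^sup>2 - \<sigma>\<^sub>1\<^sup>2) / 4) * (sqrt n / 2 ^ n) \<le> exp (tilt\<^sup>2 * var_at n n / 2 - tilt * center n)"
    unfolding e by (simp_all flip: exp_add)
qed

end

section \<open>Displacements along ancestral lines and the upper tail\<close>

locale increasing_brw = two_variance_brw M n \<sigma>\<^sub>1 \<sigma>\<^sub>2 S + increasing_variances \<sigma>\<^sub>1 \<sigma>\<^sub>2
  for M :: "'a measure" and n \<sigma>\<^sub>1 \<sigma>\<^sub>2 S
begin

abbreviation incr :: "bool list \<Rightarrow> 'a \<Rightarrow> real" where
  "incr v \<omega> \<equiv> S v \<omega> - S (butlast v) \<omega>"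

abbreviation words :: "bool list set" where
  "words \<equiv> (\<Union>k\<in>{1..n}. particles k)"

lemma displacement_eq:
  assumes "s \<le> t" "t \<le> length v"
  shows "S (take t v) \<omega> - S (take s v) \<omega> = (\<Sum>u\<in>ancestry s t v. incr u \<omega>)"
  unfolding sum_ancestry[OF assms(2)] using assms
proof (induction t rule: dec_induct)
  case base
  then show ?case by simp
next
  case (step t)
  have "{s<..Suc t} = insert (Suc t) {s<..t}" using step(1) by auto
  moreover have "butlast (take (Suc t) v) = take t v" using step by (simp add: butlast_take)
  ultimately show ?case using step by simp
qed

lemma measurable_incr: "u \<in> words \<Longrightarrow> incr u \<in> borel_measurable M"
  using increments_indep unfolding indep_vars_def by blast

lemma measurable_displacement:
  assumes "s \<le> t" "t \<le> length v" "length v \<le> n"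
  shows "(\<lambda>\<omega>. S (take t v) \<omega> - S (take s v) \<omega>) \<in> borel_measurable M"
  unfolding displacement_eq[OF assms(1,2)]
  using ancestry_subset_particles[OF assms(2,3), of s]
  by (intro borel_measurable_sum measurable_incr) auto

lemma measurable_position:
  assumes "length v \<le> n"
  shows "S v \<in> borel_measurable M"
proof -
  have "(\<lambda>\<omega>. S (take (length v) v) \<omega> - S (take 0 v) \<omega>) \<in> borel_measurable M"
    by (intro measurable_displacement assms) auto
  then show ?thesis by (subst measurable_cong[where g="\<lambda>\<omega>. S (take (length v) v) \<omega> - S (take 0 v) \<omega>"]) (auto simp: root)
qed

text \<open>A sum of independent centered normals. Strict inequality \<open>s < t\<close> keeps the
  sum nonempty, so that a density exists.\<close>

lemma distributed_displacement:
  assumes "s < t" "t \<le> length v" "length v \<le> n"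
  shows "distributed M lborel (\<lambda>\<omega>. S (take t v) \<omega> - S (take s v) \<omega>)
    (normal_density 0 (sqrt (var_at n t - var_at n s)))"
proof -
  \<comment> \<open>The phase of an increment is decided by the time of the parent, one less than
    the length of the word.\<close>
  let ?sd = "\<lambda>u :: bool list. if real (length u - 1) < real n / 2 then \<sigma>\<^sub>1 else \<sigma>\<^sub>2"
  have "distributed M lborel (\<lambda>\<omega>. \<Sum>u\<in>ancestry s t v. incr u \<omega>)
     (normal_density (\<Sum>u\<in>ancestry s t v. 0) (sqrt (\<Sum>u\<in>ancestry s t v. (?sd u)\<^sup>2)))"
  proof (rule sum_indep_normal)
    show "ancestry s t v \<noteq> {}" using assms by (auto simp: ancestry_def)
    show "indep_vars (\<lambda>i. borel) incr (ancestry s t v)"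
      using increments_indep ancestry_subset_particles[OF assms(2,3)] by (rule indep_vars_subset)
  next
    fix u assume "u \<in> ancestry s t v"
    then obtain j where j: "u = take j v" "s < j" "j \<le> t" by (auto simp: ancestry_def)
    then obtain i where i: "j = Suc i" by (cases j) auto
    have u: "u = take i v @ [v ! i]" "i < length v"
      using i j assms by (auto simp: take_Suc_conv_app_nth)
    have "distributed M lborel (\<lambda>\<omega>. S (take i v @ [v ! i]) \<omega> - S (take i v) \<omega>)
      (normal_density 0 (if real i < real n / 2 then \<sigma>\<^sub>1 else \<sigma>\<^sub>2))"
      using u assms by (intro increment_distr) (auto simp: particles_def)
    moreover have "length u - 1 = i" "butlast u = take i v" using u by auto
    ultimately show "distributed M lborel (incr u) (normal_density 0 (?sd u))"
      using u by simp
  qed (use pos in auto)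
  moreover have "(\<Sum>u\<in>ancestry s t v. (?sd u)\<^sup>2) = var_at n t - var_at n s"
  proof -
    have "(\<Sum>u\<in>ancestry s t v. (?sd u)\<^sup>2) = (\<Sum>j\<in>{s<..t}. (?sd (take j v))\<^sup>2)"
      by (rule sum_ancestry) (rule assms)
    also have "\<dots> = (\<Sum>j\<in>{s<..t}. (if real (j - 1) < real n / 2 then \<sigma>\<^sub>1 else \<sigma>\<^sub>2)\<^sup>2)"
      using assms by (intro sum.cong) (auto simp: min_def)
    finally show ?thesis using sum_var_at[of s t n] assms by simp
  qed
  ultimately show ?thesis
    using displacement_eq[of s t v] assms by simp
qed

lemma var_at_less: "s < t \<Longrightarrow> var_at n s < var_at n t"
proof -
  assume "s < t"
  then have "0 < \<sigma>\<^sub>1\<^sup>2 * real (t - s)" using pos by simp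
  then show ?thesis using var_at_bounds(1)[of s t n] \<open>s < t\<close> by linarith
qed

text \<open>The hypotheses on \<open>restrict\<close> say that \<open>P\<close> and \<open>Q\<close>
  look only at the coordinates in \<open>A\<close> and \<open>B\<close>, so both events are events
  of independent restricted families.\<close>

lemma prob_disjoint_words:
  fixes P Q :: "(bool list \<Rightarrow> real) \<Rightarrow> bool"
  assumes AB: "A \<inter> B = {}" "A \<subseteq> words" "B \<subseteq> words"
    and P: "{x \<in> space (PiM A (\<lambda>_. borel)). P x} \<in> sets (PiM A (\<lambda>_. borel))" "\<And>x. P (restrict x A) = P x"
    and Q: "{x \<in> space (PiM B (\<lambda>_. borel)). Q x} \<in> sets (PiM B (\<lambda>_. borel))" "\<And>x. Q (restrict x B) = Q x"
  shows "prob {\<omega> \<in> space M. P (\<lambda>u. incr u \<omega>) \<and> Q (\<lambda>u. incr u \<omega>)} =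
    prob {\<omega> \<in> space M. P (\<lambda>u. incr u \<omega>)} * prob {\<omega> \<in> space M. Q (\<lambda>u. incr u \<omega>)}"
proof -
  note * = indep_varD[OF indep_var_restrict[OF increments_indep AB] P(1) Q(1)]
  show ?thesis
    using * by (simp add: vimage_def space_PiM P(2) Q(2) Int_def conj_commute)
qed

lemma indep_sums:
  assumes "A \<inter> B = {}" "A \<subseteq> words" "B \<subseteq> words"
  shows "indep_var borel (\<lambda>\<omega>. \<Sum>u\<in>A. incr u \<omega>) borel (\<lambda>\<omega>. \<Sum>u\<in>B. incr u \<omega>)"
proof -
  have "indep_var borel ((\<lambda>x. \<Sum>u\<in>A. x u) \<circ> (\<lambda>\<omega>. restrict (\<lambda>u. incr u \<omega>) A))
     borel ((\<lambda>x. \<Sum>u\<in>B. x u) \<circ> (\<lambda>\<omega>. restrict (\<lambda>u. incr u \<omega>) B))"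
    by (rule indep_var_compose[OF indep_var_restrict[OF increments_indep assms]])
      (auto intro!: borel_measurable_sum)
  then show ?thesis by (simp add: comp_def)
qed

text \<open>Both orders are provided: the early barrier tilts the first of the two displacements,
  the late barrier the second.\<close>

lemma indep_displacements:
  assumes "r \<le> s" "s \<le> t" "t \<le> length v" "length v \<le> n"
  shows "indep_var borel (\<lambda>\<omega>. S (take s v) \<omega> - S (take r v) \<omega>) borel (\<lambda>\<omega>. S (take t v) \<omega> - S (take s v) \<omega>)"
    and "indep_var borel (\<lambda>\<omega>. S (take t v) \<omega> - S (take s v) \<omega>) borel (\<lambda>\<omega>. S (take s v) \<omega> - S (take r v) \<omega>)"
proof -
  have "ancestry r s v \<inter> ancestry s t v = {}" "ancestry r s v \<subseteq> words" "ancestry s t v \<subseteq> words"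
    using assms by (intro ancestry_inter_ancestry_eq_empty ancestry_subset_particles; simp)+
  then show "indep_var borel (\<lambda>\<omega>. S (take s v) \<omega> - S (take r v) \<omega>) borel (\<lambda>\<omega>. S (take t v) \<omega> - S (take s v) \<omega>)"
    "indep_var borel (\<lambda>\<omega>. S (take t v) \<omega> - S (take s v) \<omega>) borel (\<lambda>\<omega>. S (take s v) \<omega> - S (take r v) \<omega>)"
    using indep_sums[of "ancestry r s v" "ancestry s t v"] indep_sums[of "ancestry s t v" "ancestry r s v"]
      displacement_eq[of r s v] displacement_eq[of s t v] assms by (simp_all add: Int_commute)
qed

text \<open>First moment over the 2^n particles. By \<open>exp_center_bounds\<close> and the sharp
  tail bound each one contributes order 2^(-n), because the factor sqrt n cancels against the
  standard deviation, which is at least \<open>\<sigma>\<^sub>1 * sqrt n\<close>.\<close>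

lemma prob_above_center_le:
  assumes "n \<ge> 1"
  shows "prob {\<omega> \<in> space M. \<exists>v\<in>particles n. S v \<omega> \<ge> center n + y} \<le> exp (- tilt * y) / (tilt * \<sigma>\<^sub>1)"
proof -
  let ?c = "exp (- tilt * y) / (tilt * \<sigma>\<^sub>1) / 2 ^ n"
  have le: "prob {\<omega> \<in> space M. S v \<omega> \<ge> center n + y} \<le> ?c" if v: "v \<in> particles n" for v
  proof -
    have lv: "length v = n" using v by (simp add: particles_def)
    let ?V = "var_at n n"
    have "var_at n 0 = 0" by (simp add: var_at_def)
    then have V: "?V > 0" "\<sigma>\<^sub>1\<^sup>2 * n \<le> ?V"
      using var_at_less[of 0 n] var_at_bounds(1)[of 0 n n] assms by auto
    have "distributed M lborel (\<lambda>\<omega>. S (take n v) \<omega> - S (take 0 v) \<omega>) (normal_density 0 (sqrt (?V - var_at n 0)))"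
      using assms lv by (intro distributed_displacement) auto
    then have "prob {\<omega> \<in> space M. S (take n v) \<omega> - S (take 0 v) \<omega> \<ge> center n + y}
       \<le> exp (tilt\<^sup>2 * (sqrt ?V)\<^sup>2 / 2 - tilt * (center n + y)) / (tilt * sqrt ?V)"
      using V tilt_pos \<open>var_at n 0 = 0\<close> by (intro normal_tail_le_exp_div) auto
    also have "{\<omega> \<in> space M. S (take n v) \<omega> - S (take 0 v) \<omega> \<ge> center n + y} = {\<omega> \<in> space M. S v \<omega> \<ge> center n + y}"
      using lv by (auto simp: root)
    also have "exp (tilt\<^sup>2 * (sqrt ?V)\<^sup>2 / 2 - tilt * (center n + y)) =
        exp (tilt\<^sup>2 * ?V / 2 - tilt * center n) * exp (- tilt * y)"
      using V by (simp add: algebra_simps flip: exp_add)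
    also have "\<dots> / (tilt * sqrt ?V) \<le> (sqrt n / 2 ^ n) * exp (- tilt * y) / (tilt * (\<sigma>\<^sub>1 * sqrt n))"
    proof (intro frac_le mult_right_mono exp_center_bounds mult_left_mono)
      show "\<sigma>\<^sub>1 * sqrt n \<le> sqrt ?V"
        using V(2) pos by (intro real_le_rsqrt) (simp add: power_mult_distrib)
    qed (use assms pos tilt_pos in auto)
    also have "\<dots> = ?c" using assms by (simp add: field_simps)
    finally show ?thesis .
  qed
  have "{\<omega> \<in> space M. \<exists>v\<in>particles n. S v \<omega> \<ge> center n + y} = (\<Union>v\<in>particles n. {\<omega> \<in> space M. S v \<omega> \<ge> center n + y})"
    by auto
  also have "prob \<dots> \<le> (\<Sum>v\<in>particles n. prob {\<omega> \<in> space M. S v \<omega> \<ge> center n + y})"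
  proof (rule finite_measure_subadditive_finite)
    have "{\<omega> \<in> space M. S v \<omega> \<ge> center n + y} \<in> events" if "v \<in> particles n" for v
      using measurable_position[of v] that by (auto simp: particles_def)
    then show "(\<lambda>v. {\<omega> \<in> space M. S v \<omega> \<ge> center n + y}) ` particles n \<subseteq> events" by auto
  qed simp
  also have "\<dots> \<le> (\<Sum>v\<in>particles n. ?c)" by (intro sum_mono le)
  also have "\<dots> = exp (- tilt * y) / (tilt * \<sigma>\<^sub>1)" by (simp add: card_particles)
  finally show ?thesis .
qed

end

section \<open>Barriers\<close>

context increasing_variances
begin

text \<open>Per generation of the first phase, branching exceeds the tilting cost by
  \<open>gap\<close>; in the second phase the cost exceeds branching by the same amount, see
  \<open>gap_eq\<close>.\<close>

definition gap :: real where "gap = ln 2 - tilt\<^sup>2 * \<sigma>\<^sub>1\<^sup>2 / 2"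

text \<open>The slope of the barriers must be small enough that \<open>tilt * slack < gap\<close>.\<close>

definition slack :: real where "slack = gap / (2 * tilt)"

text \<open>The factor gained per time step in the probability of crossing a barrier, from the
  additional tilt \<open>slack / \<sigma>\<^sub>2\<^sup>2\<close>.\<close>

definition decay :: real where "decay = exp (- slack\<^sup>2 / (2 * \<sigma>\<^sub>2\<^sup>2))"

definition spread :: real where "spread = tilt * (\<sigma>\<^sub>2\<^sup>2 - \<sigma>\<^sub>1\<^sup>2) / 2 + 1 / tilt + 1"

text \<open>\<open>exp (- tilt)\<close> pays for the width of the end interval and the other
  exponential for a distance of at most \<open>spread * sqrt n\<close> from the tilted mean at
  variance at least \<open>\<sigma>\<^sub>1\<^sup>2 * n / 2\<close>; the denominator uses a standard
  deviation of at most \<open>\<sigma>\<^sub>2 * sqrt n\<close>.\<close>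

definition low :: real where "low = exp (- tilt - spread\<^sup>2 / \<sigma>\<^sub>1\<^sup>2) / (sqrt (2 * pi) * \<sigma>\<^sub>2)"

text \<open>The two quantities sum to \<open>tilt\<^sup>2 * eff\<close>, which is 2 ln 2, so they
  lie symmetrically about ln 2.\<close>

lemma gap_eq: "tilt\<^sup>2 * \<sigma>\<^sub>1\<^sup>2 / 2 = ln 2 - gap" "tilt\<^sup>2 * \<sigma>\<^sub>2\<^sup>2 / 2 = ln 2 + gap"
proof -
  have "tilt\<^sup>2 * \<sigma>\<^sub>1\<^sup>2 / 2 + tilt\<^sup>2 * \<sigma>\<^sub>2\<^sup>2 / 2 = tilt\<^sup>2 * eff"
    by (simp add: eff_def distrib_left add_divide_distrib)
  then show "tilt\<^sup>2 * \<sigma>\<^sub>1\<^sup>2 / 2 = ln 2 - gap" "tilt\<^sup>2 * \<sigma>\<^sub>2\<^sup>2 / 2 = ln 2 + gap"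
    unfolding tilt_sq gap_def by linarith+
qed

lemma gap_pos: "gap > 0"
proof -
  have "tilt\<^sup>2 * \<sigma>\<^sub>1\<^sup>2 < tilt\<^sup>2 * \<sigma>\<^sub>2\<^sup>2" using less tilt_pos by (intro mult_strict_left_mono) auto
  then show ?thesis using gap_eq by linarith
qed

lemma slack_pos: "slack > 0" using gap_pos tilt_pos by (simp add: slack_def)

lemma tilt_slack: "tilt * slack = gap / 2" using tilt_pos by (simp add: slack_def)

lemma decay_bounds: "0 < decay" "decay < 1"
  using slack_pos pos by (simp_all add: decay_def)

lemma low_pos: "low > 0"
  using pos by (simp add: low_def)

text \<open>At this height the crossing probabilities of both barriers, summed over all times, cost
  at most half of the end interval's probability. \<open>K\<close> depends on the variances only,
  not on \<open>n\<close> or \<open>k\<close>.\<close>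

lemma exists_height: "\<exists>K>0. 4 / (\<sigma>\<^sub>1 * (1 - decay)) * exp (- slack * K / \<sigma>\<^sub>2\<^sup>2) \<le> low / 2"
proof -
  define c where "c = 4 / (\<sigma>\<^sub>1 * (1 - decay))"
  define K where "K = max 1 (\<sigma>\<^sub>2\<^sup>2 / slack * (- ln (low / 2 / c)))"
  have c: "c > 0" using pos decay_bounds by (simp add: c_def)
  have "\<sigma>\<^sub>2\<^sup>2 / slack * (- ln (low / 2 / c)) \<le> K" by (simp add: K_def)
  then have "slack / \<sigma>\<^sub>2\<^sup>2 * (\<sigma>\<^sub>2\<^sup>2 / slack * (- ln (low / 2 / c))) \<le> slack / \<sigma>\<^sub>2\<^sup>2 * K"
    using slack_pos by (intro mult_left_mono) auto
  then have "- slack * K / \<sigma>\<^sub>2\<^sup>2 \<le> ln (low / 2 / c)"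
    using slack_pos pos by simp
  then have "exp (- slack * K / \<sigma>\<^sub>2\<^sup>2) \<le> low / 2 / c"
    using c low_pos by (subst ln_ge_iff[symmetric]) auto
  then have "c * exp (- slack * K / \<sigma>\<^sub>2\<^sup>2) \<le> low / 2" using c by (simp add: field_simps)
  moreover have "K > 0" by (simp add: K_def)
  ultimately show ?thesis unfolding c_def by blast
qed

text \<open>The rounding error is bounded and the logarithm is at most twice the square root; the
  summand 1 covers the rest of the end interval.\<close>

lemma center_close:
  assumes "m \<ge> 1"
  shows "\<bar>center m - tilt * var_at m m\<bar> + 1 \<le> spread * sqrt m"
proof -
  have "ln (real m) = 2 * ln (sqrt m)" using assms by (simp add: ln_sqrt)
  also have "\<dots> \<le> 2 * sqrt m" using assms ln_le_minus_one[of "sqrt m"] by simp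
  finally have "ln (real m) / (2 * tilt) \<le> 1 / tilt * sqrt m"
    using tilt_pos by (simp add: field_simps)
  moreover have "0 \<le> ln (real m) / (2 * tilt)" using assms tilt_pos by simp
  moreover have "center m - tilt * var_at m m = tilt * (eff * real m - var_at m m) - ln (real m) / (2 * tilt)"
    by (simp add: center_def algebra_simps)
  moreover have "0 \<le> tilt * (eff * real m - var_at m m)"
    using tilt_pos var_at_total(1)[of m] by simp
  moreover have "tilt * (eff * real m - var_at m m) \<le> tilt * ((\<sigma>\<^sub>2\<^sup>2 - \<sigma>\<^sub>1\<^sup>2) / 2)"
    using tilt_pos var_at_total(2)[of m] by (intro mult_left_mono) linarith+
  moreover have "tilt * ((\<sigma>\<^sub>2\<^sup>2 - \<sigma>\<^sub>1\<^sup>2) / 2) + 1 \<le> (tilt * ((\<sigma>\<^sub>2\<^sup>2 - \<sigma>\<^sub>1\<^sup>2) / 2) + 1) * sqrt m"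
    using assms tilt_pos less mult_left_mono[of 1 "sqrt m" "tilt * ((\<sigma>\<^sub>2\<^sup>2 - \<sigma>\<^sub>1\<^sup>2) / 2) + 1"] by simp
  moreover have "spread * sqrt m = (tilt * ((\<sigma>\<^sub>2\<^sup>2 - \<sigma>\<^sub>1\<^sup>2) / 2) + 1) * sqrt m + 1 / tilt * sqrt m"
    by (simp add: spread_def algebra_simps)
  ultimately show ?thesis by linarith
qed

text \<open>Whichever phase a split falls into, a stretch of at least a quarter of the total time
  remains on the far side of it, which provides a standard deviation of order sqrt n.\<close>

lemma half_bounds:
  assumes "4 * k \<le> m" "m \<ge> 4"
  shows "k < half m" "half m < m" "real m / 4 \<le> real (half m - k)" "real m / 4 \<le> real (m - half m)"
    "real m / 2 \<le> real (m - k)"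
proof -
  have "m \<le> 2 * half m" "2 * half m \<le> m + 1" by (auto simp: half_def)
  then have "k < half m" "half m < m" "m \<le> 4 * (half m - k)" "m \<le> 4 * (m - half m)" "m \<le> 2 * (m - k)"
    using assms by linarith+
  then show "k < half m" "half m < m" "real m / 4 \<le> real (half m - k)" "real m / 4 \<le> real (m - half m)"
    "real m / 2 \<le> real (m - k)"
    by linarith+
qed

lemma sqrt_var_at_ge:
  assumes "s \<le> t" "real m / 4 \<le> real (t - s)"
  shows "\<sigma>\<^sub>1 * sqrt m / 2 \<le> sqrt (var_at m t - var_at m s)"
proof (rule real_le_rsqrt)
  have "\<sigma>\<^sub>1\<^sup>2 * (real m / 4) \<le> \<sigma>\<^sub>1\<^sup>2 * real (t - s)" using assms by (intro mult_left_mono) auto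
  also have "\<dots> \<le> var_at m t - var_at m s" using assms by (intro var_at_bounds)
  finally show "(\<sigma>\<^sub>1 * sqrt m / 2)\<^sup>2 \<le> var_at m t - var_at m s"
    by (simp add: power_mult_distrib power_divide)
qed

end

context increasing_brw
begin

text \<open>The centering minus the drift that the tilted law gives to the first \<open>k\<close>
  steps; this much has to be gained after time \<open>k\<close>.\<close>

definition shifted :: "nat \<Rightarrow> real" where "shifted k = center n - tilt * \<sigma>\<^sub>1\<^sup>2 * real k"

text \<open>Up to constants, \<open>scale k\<close> is the probability that a given particle is counted.\<close>

definition scale :: "nat \<Rightarrow> real" where
  "scale k = exp (tilt\<^sup>2 * var_at n n / 2 - tilt * center n + tilt\<^sup>2 * \<sigma>\<^sub>1\<^sup>2 * real k / 2) / sqrt n"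

abbreviation disp :: "nat \<Rightarrow> nat \<Rightarrow> bool list \<Rightarrow> 'a \<Rightarrow> real" where
  "disp s t v \<omega> \<equiv> S (take t v) \<omega> - S (take s v) \<omega>"

abbreviation barrier :: "nat \<Rightarrow> real \<Rightarrow> nat \<Rightarrow> real" where
  "barrier k K s \<equiv> (tilt * \<sigma>\<^sub>1\<^sup>2 + slack) * real (s - k) + K"

abbreviation late_barrier :: "real \<Rightarrow> nat \<Rightarrow> real" where
  "late_barrier K s \<equiv> (tilt * \<sigma>\<^sub>2\<^sup>2 - slack) * real (n - s) - K"

text \<open>A predicate on families of increments rather than on sample points, as
  \<open>prob_disjoint_words\<close> requires. Given the end interval, the lower bound on the
  displacement after \<open>s\<close> limits from above the displacement up to
  \<open>s\<close>.\<close>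

definition admissible :: "nat \<Rightarrow> real \<Rightarrow> bool list \<Rightarrow> (bool list \<Rightarrow> real) \<Rightarrow> bool" where
  "admissible k K v x \<longleftrightarrow>
     (\<Sum>u\<in>ancestry k n v. x u) \<in> {shifted k..shifted k + 1} \<and>
     (\<forall>s\<in>{k..half n}. (\<Sum>u\<in>ancestry k s v. x u) \<le> barrier k K s) \<and>
     (\<forall>s\<in>{half n<..n}. (\<Sum>u\<in>ancestry s n v. x u) \<ge> late_barrier K s)"

definition good :: "nat \<Rightarrow> real \<Rightarrow> bool list \<Rightarrow> 'a set" where
  "good k K v = {\<omega> \<in> space M. admissible k K v (\<lambda>u. incr u \<omega>)}"

lemma scale_eq:
  "exp (tilt\<^sup>2 * (var_at n n - \<sigma>\<^sub>1\<^sup>2 * real k) / 2 - tilt * shifted k) = scale k * sqrt n" if "n \<ge> 1"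
proof -
  have "tilt\<^sup>2 * (var_at n n - \<sigma>\<^sub>1\<^sup>2 * real k) / 2 - tilt * shifted k
    = tilt\<^sup>2 * var_at n n / 2 - tilt * center n + tilt\<^sup>2 * \<sigma>\<^sub>1\<^sup>2 * real k / 2"
    by (simp add: shifted_def algebra_simps power2_eq_square diff_divide_distrib)
  then show ?thesis using that by (simp add: scale_def)
qed

lemma scale_pos: "n \<ge> 1 \<Longrightarrow> scale k > 0"
  by (simp add: scale_def)

text \<open>Up to constants this is the growth in \<open>k\<close>, uniform in \<open>n\<close>, of
  the expected number of counted particles; it is what makes the failure probability small.\<close>

lemma scale_ge:
  assumes "n \<ge> 1"
  shows "exp (- tilt\<^sup>2 * (\<sigma>\<^sub>2\<^sup>2 - \<sigma>\<^sub>1\<^sup>2) / 4) * exp (tilt\<^sup>2 * \<sigma>\<^sub>1\<^sup>2 * real k / 2) \<le> 2 ^ n * scale k"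
proof -
  have "exp (- tilt\<^sup>2 * (\<sigma>\<^sub>2\<^sup>2 - \<sigma>\<^sub>1\<^sup>2) / 4) * (sqrt n / 2 ^ n) * (2 ^ n * exp (tilt\<^sup>2 * \<sigma>\<^sub>1\<^sup>2 * real k / 2) / sqrt n)
    \<le> exp (tilt\<^sup>2 * var_at n n / 2 - tilt * center n) * (2 ^ n * exp (tilt\<^sup>2 * \<sigma>\<^sub>1\<^sup>2 * real k / 2) / sqrt n)"
    by (intro mult_right_mono exp_center_bounds assms) auto
  then show ?thesis using assms by (simp add: scale_def exp_add mult_ac)
qed

end

section \<open>Probabilities of the end interval and of barrier crossings\<close>

locale barrier_brw = increasing_brw M n \<sigma>\<^sub>1 \<sigma>\<^sub>2 S
  for M :: "'a measure" and n \<sigma>\<^sub>1 \<sigma>\<^sub>2 S +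
  fixes k :: nat and K :: real
  assumes k: "4 * k \<le> n" "n \<ge> 4" and K: "K > 0"
    and height: "4 / (\<sigma>\<^sub>1 * (1 - decay)) * exp (- slack * K / \<sigma>\<^sub>2\<^sup>2) \<le> low / 2"
begin

lemma n_pos: "n \<ge> 1" using k by simp

lemmas half_k_bounds = half_bounds[OF k]

text \<open>The end interval lies within \<open>spread * sqrt n\<close> of the tilted mean while the
  variance is of order \<open>n\<close>, so the tilted density there is at least of order 1 / sqrt
  n.\<close>

lemma unit_interval_prob_ge:
  assumes v: "length v = n"
  shows "low * scale k \<le> prob {\<omega> \<in> space M. disp k n v \<omega> \<in> {shifted k..shifted k + 1}}"
proof -
  define W where "W = var_at n n - var_at n k"
  have Vk: "var_at n k = \<sigma>\<^sub>1\<^sup>2 * real k" using half_k_bounds by (intro var_at_first) simp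
  have kn: "k < n" using half_k_bounds by simp
  have W0: "W > 0" using var_at_less[OF kn] by (simp add: W_def)
  have Wup: "W \<le> \<sigma>\<^sub>2\<^sup>2 * real n"
  proof -
    have "W \<le> \<sigma>\<^sub>2\<^sup>2 * real (n - k)" unfolding W_def using kn by (intro var_at_bounds) simp
    also have "\<dots> \<le> \<sigma>\<^sub>2\<^sup>2 * real n" by (intro mult_left_mono) auto
    finally show ?thesis .
  qed
  have Wlow: "\<sigma>\<^sub>1\<^sup>2 * real n / 2 \<le> W"
  proof -
    have "\<sigma>\<^sub>1\<^sup>2 * (real n / 2) \<le> \<sigma>\<^sub>1\<^sup>2 * real (n - k)" using half_k_bounds by (intro mult_left_mono) auto
    also have "\<dots> \<le> W" unfolding W_def using kn by (intro var_at_bounds) simp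
    finally show ?thesis by simp
  qed
  have D: "\<bar>shifted k - tilt * (sqrt W)\<^sup>2\<bar> + 1 \<le> spread * sqrt n"
  proof -
    \<comment> \<open>The drift removed in \<open>shifted k\<close> matches the variance of the
      first \<open>k\<close> steps, which reduces the distance to the one in
      \<open>center_close\<close>.\<close>
    have "shifted k - tilt * (sqrt W)\<^sup>2 = center n - tilt * var_at n n"
      using W0 by (simp add: shifted_def W_def Vk algebra_simps)
    then show ?thesis using center_close[OF n_pos] by simp
  qed
  have "low * scale k = scale k * sqrt n * exp (- tilt - spread\<^sup>2 / \<sigma>\<^sub>1\<^sup>2) / (sqrt (2 * pi) * (\<sigma>\<^sub>2 * sqrt n))"
    using n_pos by (simp add: low_def)
  also have "\<dots> \<le> scale k * sqrt n * exp (- tilt - (spread * sqrt n)\<^sup>2 / (2 * W)) / (sqrt (2 * pi) * sqrt W)"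
  proof (intro frac_le mult_left_mono)
    have "(spread * sqrt n)\<^sup>2 / (2 * W) \<le> (spread * sqrt n)\<^sup>2 / (\<sigma>\<^sub>1\<^sup>2 * real n)"
      using Wlow pos n_pos W0 by (intro divide_left_mono mult_pos_pos) auto
    also have "\<dots> = spread\<^sup>2 / \<sigma>\<^sub>1\<^sup>2" using n_pos by (simp add: power_mult_distrib)
    finally show "exp (- tilt - spread\<^sup>2 / \<sigma>\<^sub>1\<^sup>2) \<le> exp (- tilt - (spread * sqrt n)\<^sup>2 / (2 * W))" by simp
    have "sqrt W \<le> sqrt (\<sigma>\<^sub>2\<^sup>2 * real n)" using Wup by simp
    then show "sqrt W \<le> \<sigma>\<^sub>2 * sqrt n" using pos by (simp add: real_sqrt_mult)
  qed (use W0 scale_pos[OF n_pos] in \<open>auto simp: less_imp_le\<close>)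
  also have "scale k * sqrt n * exp (- tilt - (spread * sqrt n)\<^sup>2 / (2 * W)) =
      exp (tilt\<^sup>2 * (sqrt W)\<^sup>2 / 2 - tilt * (shifted k + 1) - (spread * sqrt n)\<^sup>2 / (2 * (sqrt W)\<^sup>2))"
  proof -
    have "tilt\<^sup>2 * (sqrt W)\<^sup>2 / 2 - tilt * (shifted k + 1) - (spread * sqrt n)\<^sup>2 / (2 * (sqrt W)\<^sup>2)
      = (tilt\<^sup>2 * (var_at n n - \<sigma>\<^sub>1\<^sup>2 * real k) / 2 - tilt * shifted k) + (- tilt - (spread * sqrt n)\<^sup>2 / (2 * W))"
      using W0 by (simp add: W_def Vk distrib_left)
    then show ?thesis unfolding scale_eq[OF n_pos, symmetric] by (simp only: exp_add)
  qed
  also have "exp (tilt\<^sup>2 * (sqrt W)\<^sup>2 / 2 - tilt * (shifted k + 1) - (spread * sqrt n)\<^sup>2 / (2 * (sqrt W)\<^sup>2)) / (sqrt (2 * pi) * sqrt W)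
     \<le> prob {\<omega> \<in> space M. disp k n v \<omega> \<in> {shifted k..shifted k + 1}}"
  proof (rule normal_unit_interval_ge[OF _ _ _ D])
    show "distributed M lborel (disp k n v) (normal_density 0 (sqrt W))"
      unfolding W_def using v kn by (intro distributed_displacement) auto
  qed (use W0 tilt_pos in auto)
  finally show ?thesis .
qed

text \<open>A crossing at time \<open>s\<close> exceeds the tilted mean by
  \<open>slack * real (s - k) + K\<close>, a large deviation that the second tilt of
  \<open>normal_sum_unit_interval_le\<close> turns into exponential decay in \<open>s - k\<close>.
  The displacement after \<open>s\<close> supplies the factor 1 / sqrt n.\<close>

lemma barrier_violation_le:
  assumes v: "length v = n" and s: "k < s" "s \<le> half n"
  shows "prob {\<omega> \<in> space M. disp k n v \<omega> \<in> {shifted k..shifted k + 1} \<and> disp k s v \<omega> > barrier k K s}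
    \<le> scale k * (2 / \<sigma>\<^sub>1) * exp (- slack * K / \<sigma>\<^sub>2\<^sup>2) * decay ^ (s - k)"
proof -
  define \<tau> where "\<tau> = sqrt (var_at n s - var_at n k)"
  define \<rho> where "\<rho> = sqrt (var_at n n - var_at n s)"
  \<comment> \<open>The second tilt \<open>slack / \<sigma>\<^sub>2\<^sup>2\<close> times the excess
    over the tilted mean. It optimizes the linear part for variance
    \<open>\<sigma>\<^sub>2\<^sup>2\<close> per step, and the smaller variance of the first phase
    only helps.\<close>
  define c where "c = slack / \<sigma>\<^sub>2\<^sup>2 * (slack * real (s - k) + K)"
  have sn: "s < n" using s half_k_bounds by simp
  have Vk: "var_at n k = \<sigma>\<^sub>1\<^sup>2 * real k" "var_at n s = \<sigma>\<^sub>1\<^sup>2 * real s"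
    using s by (simp_all add: var_at_first)
  have \<tau>2: "\<tau>\<^sup>2 = \<sigma>\<^sub>1\<^sup>2 * real (s - k)" using s by (simp add: \<tau>_def Vk mult_left_mono right_diff_distrib)
  have \<rho>2: "\<rho>\<^sup>2 = var_at n n - var_at n s" using var_at_less[OF sn] by (simp add: \<rho>_def)
  have \<rho>: "\<sigma>\<^sub>1 * sqrt n / 2 \<le> \<rho>"
    unfolding \<rho>_def using s half_k_bounds sn by (intro sqrt_var_at_ge) auto
  have pos': "\<tau> > 0" "\<rho> > 0" using var_at_less[OF sn] var_at_less[OF s(1)] by (simp_all add: \<tau>_def \<rho>_def)
  have dX: "distributed M lborel (disp k s v) (normal_density 0 \<tau>)"
    and dY: "distributed M lborel (disp s n v) (normal_density 0 \<rho>)"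
    unfolding \<tau>_def \<rho>_def using v s sn by (intro distributed_displacement; simp)+
  have ind: "indep_var borel (disp k s v) borel (disp s n v)"
    using v s sn by (intro indep_displacements) auto
  have meas [measurable]: "disp k s v \<in> borel_measurable M" "disp s n v \<in> borel_measurable M"
    using v s sn by (intro measurable_displacement; simp)+
  have "prob {\<omega> \<in> space M. disp k n v \<omega> \<in> {shifted k..shifted k + 1} \<and> disp k s v \<omega> > barrier k K s}
    \<le> prob {\<omega> \<in> space M. disp k s v \<omega> + disp s n v \<omega> \<in> {shifted k..shifted k + 1} \<and>
        slack / \<sigma>\<^sub>2\<^sup>2 * (disp k s v \<omega> - tilt * \<tau>\<^sup>2) \<ge> c}"
  proof (rule finite_measure_mono)
    have "c \<le> slack / \<sigma>\<^sub>2\<^sup>2 * (z - tilt * \<tau>\<^sup>2)" if "barrier k K s < z" for z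
      unfolding c_def \<tau>2 using that slack_pos
      by (intro mult_left_mono) (auto simp: algebra_simps simp del: of_nat_diff)
    then show "{\<omega> \<in> space M. disp k n v \<omega> \<in> {shifted k..shifted k + 1} \<and> disp k s v \<omega> > barrier k K s}
     \<subseteq> {\<omega> \<in> space M. disp k s v \<omega> + disp s n v \<omega> \<in> {shifted k..shifted k + 1} \<and>
        slack / \<sigma>\<^sub>2\<^sup>2 * (disp k s v \<omega> - tilt * \<tau>\<^sup>2) \<ge> c}" by auto
    show "{\<omega> \<in> space M. disp k s v \<omega> + disp s n v \<omega> \<in> {shifted k..shifted k + 1} \<and>
        slack / \<sigma>\<^sub>2\<^sup>2 * (disp k s v \<omega> - tilt * \<tau>\<^sup>2) \<ge> c} \<in> events"
      unfolding atLeastAtMost_iff by measurable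
  qed
  also have "\<dots> \<le> exp (tilt\<^sup>2 * (\<tau>\<^sup>2 + \<rho>\<^sup>2) / 2 - tilt * shifted k) / \<rho> * exp ((slack / \<sigma>\<^sub>2\<^sup>2)\<^sup>2 * \<tau>\<^sup>2 / 2 - c)"
    using pos' tilt_pos by (intro normal_sum_unit_interval_le dX dY ind) auto
  also have "\<dots> \<le> (scale k * sqrt n) / (\<sigma>\<^sub>1 * sqrt n / 2) * exp (- slack * K / \<sigma>\<^sub>2\<^sup>2 + real (s - k) * (- slack\<^sup>2 / (2 * \<sigma>\<^sub>2\<^sup>2)))"
  proof (intro mult_mono frac_le)
    have "\<tau>\<^sup>2 + \<rho>\<^sup>2 = var_at n n - \<sigma>\<^sub>1\<^sup>2 * real k" using s unfolding \<tau>2 \<rho>2 Vk by (simp add: algebra_simps)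
    then show "exp (tilt\<^sup>2 * (\<tau>\<^sup>2 + \<rho>\<^sup>2) / 2 - tilt * shifted k) \<le> scale k * sqrt n"
      using scale_eq[OF n_pos] by simp
    have "(slack / \<sigma>\<^sub>2\<^sup>2)\<^sup>2 * \<tau>\<^sup>2 \<le> (slack / \<sigma>\<^sub>2\<^sup>2)\<^sup>2 * (\<sigma>\<^sub>2\<^sup>2 * real (s - k))"
      unfolding \<tau>2 using less by (intro mult_left_mono mult_right_mono) auto
    also have "\<dots> = slack\<^sup>2 / \<sigma>\<^sub>2\<^sup>2 * real (s - k)" using pos by (simp add: power2_eq_square)
    finally show "exp ((slack / \<sigma>\<^sub>2\<^sup>2)\<^sup>2 * \<tau>\<^sup>2 / 2 - c) \<le> exp (- slack * K / \<sigma>\<^sub>2\<^sup>2 + real (s - k) * (- slack\<^sup>2 / (2 * \<sigma>\<^sub>2\<^sup>2)))"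
      unfolding c_def by (simp add: power2_eq_square distrib_left algebra_simps add_divide_distrib del: of_nat_diff)
  qed (use \<rho> pos n_pos scale_pos[OF n_pos] pos' in \<open>auto simp: less_imp_le\<close>)
  also have "\<dots> = scale k * (2 / \<sigma>\<^sub>1) * exp (- slack * K / \<sigma>\<^sub>2\<^sup>2) * decay ^ (s - k)"
    unfolding exp_add exp_of_nat_mult decay_def[symmetric] using n_pos by simp
  finally show ?thesis .
qed

text \<open>The mirror image: the tilted piece is now the displacement from \<open>s\<close> to
  \<open>n\<close>, the second tilt is negative because the piece falls short, and the earlier
  displacement supplies the factor 1 / sqrt n.\<close>

lemma late_barrier_violation_le:
  assumes v: "length v = n" and s: "half n < s" "s < n"
  shows "prob {\<omega> \<in> space M. disp k n v \<omega> \<in> {shifted k..shifted k + 1} \<and> disp s n v \<omega> < late_barrier K s}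
    \<le> scale k * (2 / \<sigma>\<^sub>1) * exp (- slack * K / \<sigma>\<^sub>2\<^sup>2) * decay ^ (n - s)"
proof -
  define \<tau> where "\<tau> = sqrt (var_at n n - var_at n s)"
  define \<rho> where "\<rho> = sqrt (var_at n s - var_at n k)"
  define c where "c = slack / \<sigma>\<^sub>2\<^sup>2 * (slack * real (n - s) + K)"
  have ks: "k < s" using s half_k_bounds by simp
  have Vk: "var_at n k = \<sigma>\<^sub>1\<^sup>2 * real k" using half_k_bounds by (simp add: var_at_first)
  have Vs: "var_at n n - var_at n s = \<sigma>\<^sub>2\<^sup>2 * real (n - s)" using s by (intro var_at_last) auto
  have \<tau>2: "\<tau>\<^sup>2 = \<sigma>\<^sub>2\<^sup>2 * real (n - s)" unfolding \<tau>_def Vs by simp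
  have \<rho>2: "\<rho>\<^sup>2 = var_at n s - var_at n k" using var_at_less[OF ks] by (simp add: \<rho>_def)
  have \<rho>: "\<sigma>\<^sub>1 * sqrt n / 2 \<le> \<rho>"
    unfolding \<rho>_def using s half_k_bounds ks by (intro sqrt_var_at_ge) auto
  have pos': "\<tau> > 0" "\<rho> > 0" using var_at_less[OF ks] var_at_less[OF s(2)] by (simp_all add: \<tau>_def \<rho>_def)
  have dX: "distributed M lborel (disp s n v) (normal_density 0 \<tau>)"
    and dY: "distributed M lborel (disp k s v) (normal_density 0 \<rho>)"
    unfolding \<tau>_def \<rho>_def using v s ks by (intro distributed_displacement; simp)+
  have ind: "indep_var borel (disp s n v) borel (disp k s v)"
    using v s ks by (intro indep_displacements) auto
  have meas [measurable]: "disp k s v \<in> borel_measurable M" "disp s n v \<in> borel_measurable M"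
    using v s ks by (intro measurable_displacement; simp)+
  have "prob {\<omega> \<in> space M. disp k n v \<omega> \<in> {shifted k..shifted k + 1} \<and> disp s n v \<omega> < late_barrier K s}
    \<le> prob {\<omega> \<in> space M. disp s n v \<omega> + disp k s v \<omega> \<in> {shifted k..shifted k + 1} \<and>
        - (slack / \<sigma>\<^sub>2\<^sup>2) * (disp s n v \<omega> - tilt * \<tau>\<^sup>2) \<ge> c}"
  proof (rule finite_measure_mono)
    have "c \<le> - (slack / \<sigma>\<^sub>2\<^sup>2) * (z - tilt * \<tau>\<^sup>2)" if "z < late_barrier K s" for z
    proof -
      have "slack / \<sigma>\<^sub>2\<^sup>2 * (slack * real (n - s) + K) \<le> slack / \<sigma>\<^sub>2\<^sup>2 * (tilt * \<tau>\<^sup>2 - z)"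
        unfolding \<tau>2 using that slack_pos
        by (intro mult_left_mono) (auto simp: algebra_simps simp del: of_nat_diff)
      then show ?thesis by (simp add: c_def right_diff_distrib)
    qed
    then show "{\<omega> \<in> space M. disp k n v \<omega> \<in> {shifted k..shifted k + 1} \<and> disp s n v \<omega> < late_barrier K s}
     \<subseteq> {\<omega> \<in> space M. disp s n v \<omega> + disp k s v \<omega> \<in> {shifted k..shifted k + 1} \<and>
        - (slack / \<sigma>\<^sub>2\<^sup>2) * (disp s n v \<omega> - tilt * \<tau>\<^sup>2) \<ge> c}" by auto
    show "{\<omega> \<in> space M. disp s n v \<omega> + disp k s v \<omega> \<in> {shifted k..shifted k + 1} \<and>
        - (slack / \<sigma>\<^sub>2\<^sup>2) * (disp s n v \<omega> - tilt * \<tau>\<^sup>2) \<ge> c} \<in> events"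
      unfolding atLeastAtMost_iff by measurable
  qed
  also have "\<dots> \<le> exp (tilt\<^sup>2 * (\<tau>\<^sup>2 + \<rho>\<^sup>2) / 2 - tilt * shifted k) / \<rho> * exp ((- (slack / \<sigma>\<^sub>2\<^sup>2))\<^sup>2 * \<tau>\<^sup>2 / 2 - c)"
    using pos' tilt_pos by (intro normal_sum_unit_interval_le dX dY ind) auto
  also have "\<dots> \<le> (scale k * sqrt n) / (\<sigma>\<^sub>1 * sqrt n / 2) * exp (- slack * K / \<sigma>\<^sub>2\<^sup>2 + real (n - s) * (- slack\<^sup>2 / (2 * \<sigma>\<^sub>2\<^sup>2)))"
  proof (intro mult_mono frac_le)
    have "\<tau>\<^sup>2 + \<rho>\<^sup>2 = var_at n n - \<sigma>\<^sub>1\<^sup>2 * real k" unfolding \<tau>2 \<rho>2 Vs[symmetric] Vk by simp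
    then show "exp (tilt\<^sup>2 * (\<tau>\<^sup>2 + \<rho>\<^sup>2) / 2 - tilt * shifted k) \<le> scale k * sqrt n"
      using scale_eq[OF n_pos] by simp
    have "(- (slack / \<sigma>\<^sub>2\<^sup>2))\<^sup>2 * \<tau>\<^sup>2 = slack\<^sup>2 / \<sigma>\<^sub>2\<^sup>2 * real (n - s)"
      unfolding \<tau>2 using pos by (simp add: power2_eq_square del: of_nat_diff)
    then show "exp ((- (slack / \<sigma>\<^sub>2\<^sup>2))\<^sup>2 * \<tau>\<^sup>2 / 2 - c) \<le> exp (- slack * K / \<sigma>\<^sub>2\<^sup>2 + real (n - s) * (- slack\<^sup>2 / (2 * \<sigma>\<^sub>2\<^sup>2)))"
      unfolding c_def by (simp add: power2_eq_square distrib_left algebra_simps add_divide_distrib del: of_nat_diff)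
  qed (use \<rho> pos n_pos scale_pos[OF n_pos] pos' in \<open>auto simp: less_imp_le\<close>)
  also have "\<dots> = scale k * (2 / \<sigma>\<^sub>1) * exp (- slack * K / \<sigma>\<^sub>2\<^sup>2) * decay ^ (n - s)"
    unfolding exp_add exp_of_nat_mult decay_def[symmetric] using n_pos by simp
  finally show ?thesis .
qed

end

section \<open>Counting particles below the barriers\<close>

context barrier_brw
begin

lemma good_eq:
  assumes v: "length v = n"
  shows "good k K v = {\<omega> \<in> space M. disp k n v \<omega> \<in> {shifted k..shifted k + 1} \<and>
     (\<forall>s\<in>{k..half n}. disp k s v \<omega> \<le> barrier k K s) \<and>
     (\<forall>s\<in>{half n<..n}. disp s n v \<omega> \<ge> late_barrier K s)}"
proof -
  have d: "(\<Sum>u\<in>ancestry s t v. incr u \<omega>) = disp s t v \<omega>" if "s \<le> t" "t \<le> n" for s t \<omega>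
    using displacement_eq[of s t v] v that by simp
  have "admissible k K v (\<lambda>u. incr u \<omega>) \<longleftrightarrow> disp k n v \<omega> \<in> {shifted k..shifted k + 1} \<and>
     (\<forall>s\<in>{k..half n}. disp k s v \<omega> \<le> barrier k K s) \<and>
     (\<forall>s\<in>{half n<..n}. disp s n v \<omega> \<ge> late_barrier K s)" for \<omega>
    unfolding admissible_def
  proof (intro conj_cong ball_cong refl)
    show "((\<Sum>u\<in>ancestry k n v. incr u \<omega>) \<in> {shifted k..shifted k + 1}) = (disp k n v \<omega> \<in> {shifted k..shifted k + 1})"
      by (subst d) (use half_k_bounds in auto)
    show "((\<Sum>u\<in>ancestry k s v. incr u \<omega>) \<le> barrier k K s) = (disp k s v \<omega> \<le> barrier k K s)" if "s \<in> {k..half n}" for s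
      by (subst d) (use that half_k_bounds in auto)
    show "(late_barrier K s \<le> (\<Sum>u\<in>ancestry s n v. incr u \<omega>)) = (late_barrier K s \<le> disp s n v \<omega>)" if "s \<in> {half n<..n}" for s
      by (subst d) (use that in auto)
  qed
  then show ?thesis unfolding good_def by blast
qed

lemma sum_measurable_PiM:
  fixes A :: "bool list set"
  assumes "B \<subseteq> A"
  shows "(\<lambda>x. \<Sum>u\<in>B. x u :: real) \<in> borel_measurable (PiM A (\<lambda>_. borel))"
  using assms by (intro borel_measurable_sum measurable_component_singleton) auto

lemma admissible_measurable:
  "{x \<in> space (PiM (ancestry k n v) (\<lambda>_. borel)). admissible k K v x} \<in> sets (PiM (ancestry k n v) (\<lambda>_. borel))"
proof -
  have m: "(\<lambda>x. \<Sum>u\<in>ancestry s t v. x u :: real) \<in> borel_measurable (PiM (ancestry k n v) (\<lambda>_. borel))"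
    if "k \<le> s" "t \<le> n" for s t
    using that by (intro sum_measurable_PiM ancestry_subset)
  show ?thesis
    unfolding admissible_def
  proof (intro sets.sets_Collect_conj sets.sets_Collect_finite_All)
    show "{x \<in> space (PiM (ancestry k n v) (\<lambda>_. borel)). (\<Sum>u\<in>ancestry k n v. x u) \<in> {shifted k..shifted k + 1}}
      \<in> sets (PiM (ancestry k n v) (\<lambda>_. borel))"
      unfolding atLeastAtMost_iff
      by (intro sets.sets_Collect_conj borel_measurable_le borel_measurable_const m) auto
    show "{x \<in> space (PiM (ancestry k n v) (\<lambda>_. borel)). (\<Sum>u\<in>ancestry k s v. x u) \<le> barrier k K s}
      \<in> sets (PiM (ancestry k n v) (\<lambda>_. borel))" if "s \<in> {k..half n}" for s
      using that half_k_bounds by (intro borel_measurable_le borel_measurable_const m) auto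
    show "{x \<in> space (PiM (ancestry k n v) (\<lambda>_. borel)). late_barrier K s \<le> (\<Sum>u\<in>ancestry s n v. x u)}
      \<in> sets (PiM (ancestry k n v) (\<lambda>_. borel))" if "s \<in> {half n<..n}" for s
      using that half_k_bounds by (intro borel_measurable_le borel_measurable_const m) auto
  qed auto
qed

lemma admissible_restrict: "admissible k K v (restrict x (ancestry k n v)) = admissible k K v x"
proof -
  have r: "(\<Sum>u\<in>ancestry s t v. restrict x (ancestry k n v) u) = (\<Sum>u\<in>ancestry s t v. x u)"
    if "k \<le> s" "t \<le> n" for s t
    using that ancestry_subset[of k s t n v] by (intro sum.cong) auto
  show ?thesis
    unfolding admissible_def
  proof (intro conj_cong ball_cong refl)
    show "((\<Sum>u\<in>ancestry k n v. restrict x (ancestry k n v) u) \<in> {shifted k..shifted k + 1}) =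
        ((\<Sum>u\<in>ancestry k n v. x u) \<in> {shifted k..shifted k + 1})"
      by (subst r) auto
    show "((\<Sum>u\<in>ancestry k s v. restrict x (ancestry k n v) u) \<le> barrier k K s) =
        ((\<Sum>u\<in>ancestry k s v. x u) \<le> barrier k K s)" if "s \<in> {k..half n}" for s
      by (subst r) (use that half_k_bounds in auto)
    show "(late_barrier K s \<le> (\<Sum>u\<in>ancestry s n v. restrict x (ancestry k n v) u)) =
        (late_barrier K s \<le> (\<Sum>u\<in>ancestry s n v. x u))" if "s \<in> {half n<..n}" for s
      by (subst r) (use that half_k_bounds in auto)
  qed
qed

lemma good_events:
  assumes v: "length v = n"
  shows "good k K v \<in> events"
proof -
  have m: "disp s t v \<in> borel_measurable M" if "s \<le> t" "t \<le> n" for s t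
    using v that by (intro measurable_displacement) auto
  show ?thesis
    unfolding good_eq[OF v]
  proof (intro sets.sets_Collect_conj sets.sets_Collect_finite_All)
    show "{\<omega> \<in> space M. disp k n v \<omega> \<in> {shifted k..shifted k + 1}} \<in> events"
      unfolding atLeastAtMost_iff using half_k_bounds
      by (intro sets.sets_Collect_conj borel_measurable_le borel_measurable_const m) auto
    show "{\<omega> \<in> space M. disp k s v \<omega> \<le> barrier k K s} \<in> events" if "s \<in> {k..half n}" for s
      using that half_k_bounds by (intro borel_measurable_le borel_measurable_const m) auto
    show "{\<omega> \<in> space M. late_barrier K s \<le> disp s n v \<omega>} \<in> events" if "s \<in> {half n<..n}" for s
      using that half_k_bounds by (intro borel_measurable_le borel_measurable_const m) auto
  qed auto
qed

text \<open>From the probability of the end interval subtract the crossing probabilities of both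
  barriers; they form geometric series, and \<open>height\<close> keeps their total below
  half.\<close>

lemma good_prob_ge:
  assumes v: "length v = n"
  shows "low / 2 * scale k \<le> prob (good k K v)"
proof -
  let ?I = "\<lambda>\<omega>. disp k n v \<omega> \<in> {shifted k..shifted k + 1}"
  let ?E = "\<lambda>s. {\<omega> \<in> space M. ?I \<omega> \<and> disp k s v \<omega> > barrier k K s}"
  let ?L = "\<lambda>s. {\<omega> \<in> space M. ?I \<omega> \<and> disp s n v \<omega> < late_barrier K s}"
  let ?A = "{k<..half n}" and ?B = "{half n<..<n}"
  define c where "c = scale k * (2 / \<sigma>\<^sub>1) * exp (- slack * K / \<sigma>\<^sub>2\<^sup>2)"
  have m: "disp s t v \<in> borel_measurable M" if "s \<le> t" "t \<le> n" for s t
    using v that by (intro measurable_displacement) auto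
  have kn: "k \<le> n" using half_k_bounds by simp
  note [measurable] = m[OF kn order_refl]
  have E: "?E s \<in> events" if "s \<in> ?A" for s
  proof -
    have [measurable]: "disp k s v \<in> borel_measurable M" using that half_k_bounds by (intro m) auto
    show ?thesis unfolding atLeastAtMost_iff by measurable
  qed
  have L: "?L s \<in> events" if "s \<in> ?B" for s
  proof -
    have [measurable]: "disp s n v \<in> borel_measurable M" using that half_k_bounds by (intro m) auto
    show ?thesis unfolding atLeastAtMost_iff by measurable
  qed
  have EL: "(\<Union>s\<in>?A. ?E s) \<in> events" "(\<Union>s\<in>?B. ?L s) \<in> events"
    by (intro sets.finite_UN E L finite_greaterThanAtMost finite_greaterThanLessThan; assumption)+
  have c: "0 \<le> c" using pos scale_pos[OF n_pos, of k] by (simp add: c_def)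
  have "prob (\<Union>s\<in>?A. ?E s) \<le> (\<Sum>s\<in>?A. prob (?E s))"
    by (intro finite_measure_subadditive_finite image_subsetI E) simp_all
  also have "\<dots> \<le> (\<Sum>s\<in>?A. c * decay ^ (s - k))"
    by (intro sum_mono barrier_violation_le[OF v, folded c_def]) simp_all
  also have "\<dots> \<le> c * (1 / (1 - decay))"
    unfolding sum_distrib_left[symmetric]
    by (intro mult_left_mono sum_geometric_le c less_imp_le[OF decay_bounds(1)] decay_bounds) (auto simp: inj_on_def)
  finally have e: "prob (\<Union>s\<in>?A. ?E s) \<le> c * (1 / (1 - decay))" .
  have "prob (\<Union>s\<in>?B. ?L s) \<le> (\<Sum>s\<in>?B. prob (?L s))"
    by (intro finite_measure_subadditive_finite image_subsetI L) simp_all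
  also have "\<dots> \<le> (\<Sum>s\<in>?B. c * decay ^ (n - s))"
    by (intro sum_mono late_barrier_violation_le[OF v, folded c_def]) simp_all
  also have "\<dots> \<le> c * (1 / (1 - decay))"
    unfolding sum_distrib_left[symmetric]
    by (intro mult_left_mono sum_geometric_le c less_imp_le[OF decay_bounds(1)] decay_bounds) (auto simp: inj_on_def)
  finally have l: "prob (\<Union>s\<in>?B. ?L s) \<le> c * (1 / (1 - decay))" .
  have "low * scale k \<le> prob {\<omega> \<in> space M. ?I \<omega>}" by (rule unit_interval_prob_ge[OF v])
  also have "\<dots> \<le> prob (good k K v \<union> ((\<Union>s\<in>?A. ?E s) \<union> (\<Union>s\<in>?B. ?L s)))"
  proof (rule finite_measure_mono)
    show "{\<omega> \<in> space M. ?I \<omega>} \<subseteq> good k K v \<union> ((\<Union>s\<in>?A. ?E s) \<union> (\<Union>s\<in>?B. ?L s))"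
    proof (rule subsetI, rule ccontr)
      fix \<omega> assume \<omega>: "\<omega> \<in> {\<omega> \<in> space M. ?I \<omega>}"
        and n: "\<omega> \<notin> good k K v \<union> ((\<Union>s\<in>?A. ?E s) \<union> (\<Union>s\<in>?B. ?L s))"
      \<comment> \<open>At \<open>s = k\<close> the displacement is 0 and the barrier is at
        \<open>K > 0\<close>, so this time needs no event in the union. Likewise the late barrier is
        at \<open>- K\<close> when \<open>s = n\<close>.\<close>
      have "disp k s v \<omega> \<le> barrier k K s" if "s \<in> {k..half n}" for s
      proof (cases "s = k")
        case False
        then have "s \<in> ?A" using that by auto
        then have "\<omega> \<notin> ?E s" using n by blast
        then show ?thesis using \<omega> by (simp add: not_less)
      qed (use K in simp)
      moreover have "disp s n v \<omega> \<ge> late_barrier K s" if "s \<in> {half n<..n}" for s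
      proof (cases "s = n")
        case False
        then have "s \<in> ?B" using that by auto
        then have "\<omega> \<notin> ?L s" using n by blast
        then show ?thesis using \<omega> by (simp add: not_less)
      qed (use K in simp)
      ultimately show False using n \<omega> unfolding good_eq[OF v] by blast
    qed
    show "good k K v \<union> ((\<Union>s\<in>?A. ?E s) \<union> (\<Union>s\<in>?B. ?L s)) \<in> events"
      using good_events[OF v] EL by (intro sets.Un)
  qed
  also have "\<dots> \<le> prob (good k K v) + (prob (\<Union>s\<in>?A. ?E s) + prob (\<Union>s\<in>?B. ?L s))"
  proof -
    note * = measure_Un_le[OF good_events[OF v] sets.Un[OF EL]] measure_Un_le[OF EL]
    show ?thesis using * by linarith
  qed
  finally have "low * scale k \<le> prob (good k K v) + 2 * (c * (1 / (1 - decay)))"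
    using e l by linarith
  moreover have "2 * (c * (1 / (1 - decay))) = scale k * (4 / (\<sigma>\<^sub>1 * (1 - decay)) * exp (- slack * K / \<sigma>\<^sub>2\<^sup>2))"
    by (simp add: c_def)
  moreover have "\<dots> \<le> scale k * (low / 2)"
    using height scale_pos[OF n_pos, of k] by (intro mult_left_mono) auto
  ultimately have "low * scale k \<le> prob (good k K v) + scale k * (low / 2)" by linarith
  then show ?thesis by (simp add: mult.commute)
qed

text \<open>Bounds the conditional probability that a second particle is good, given a good one from which
  it split at time \<open>s\<close>.\<close>

definition branch_bound :: "nat \<Rightarrow> real" where
  "branch_bound s = (if s \<le> half n
     then scale k * (2 / (tilt * \<sigma>\<^sub>1)) * exp (tilt * K + (ln 2 - gap / 2) * real (s - k))
     else exp (tilt * (K + 1) - (ln 2 + gap / 2) * real (n - s)))"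

lemma branch_bound_nonneg: "branch_bound s \<ge> 0"
  using pos tilt_pos scale_pos[OF n_pos, of k] by (simp add: branch_bound_def)

text \<open>After the split the line of \<open>w\<close> shares no word with the line of
  \<open>v\<close> after time \<open>k\<close>, so the events use disjoint increments. Keeping only
  a tail event of \<open>w\<close> reduces the pair to a one-particle estimate.\<close>

lemma good_tail_prob_eq:
  assumes v: "length v = n" and w: "length w = n"
    and s: "k \<le> s" "s < n" and split: "take (Suc s) v \<noteq> take (Suc s) w"
  shows "prob (good k K v \<inter> {\<omega> \<in> space M. disp s n w \<omega> \<ge> c})
    = prob (good k K v) * prob {\<omega> \<in> space M. disp s n w \<omega> \<ge> c}"
proof -
  let ?Q = "\<lambda>x. (\<Sum>u\<in>ancestry s n w. x u) \<ge> c"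
  have d: "disp s n w \<omega> = (\<Sum>u\<in>ancestry s n w. incr u \<omega>)" for \<omega>
    using w s by (intro displacement_eq) auto
  have "prob {\<omega> \<in> space M. admissible k K v (\<lambda>u. incr u \<omega>) \<and> ?Q (\<lambda>u. incr u \<omega>)} =
    prob {\<omega> \<in> space M. admissible k K v (\<lambda>u. incr u \<omega>)} * prob {\<omega> \<in> space M. ?Q (\<lambda>u. incr u \<omega>)}"
  proof (rule prob_disjoint_words)
    show "ancestry k n v \<inter> ancestry s n w = {}"
      using v w split by (rule ancestry_disjoint) simp
    show "ancestry k n v \<subseteq> words" "ancestry s n w \<subseteq> words"
      using v w by (intro ancestry_subset_particles; simp)+
    show "{x \<in> space (PiM (ancestry s n w) (\<lambda>_. borel)). ?Q x} \<in> sets (PiM (ancestry s n w) (\<lambda>_. borel))"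
      by (intro borel_measurable_le borel_measurable_const sum_measurable_PiM) auto
    show "?Q (restrict x (ancestry s n w)) = ?Q x" for x
      by (simp cong: sum.cong)
  qed (rule admissible_measurable admissible_restrict)+
  then show ?thesis
    unfolding good_def d by (simp add: Int_def conj_ac)
qed

text \<open>The barrier of \<open>v\<close> limits from above the displacement shared with
  \<open>w\<close> up to the split, which forces \<open>w\<close> to make up the rest independently
  afterwards.\<close>

lemma good_inter_le:
  assumes v: "length v = n" and w: "length w = n"
    and s: "k \<le> s" "s \<le> n" and eq: "take s v = take s w"
    and split: "s < n \<longrightarrow> take (Suc s) v \<noteq> take (Suc s) w"
  shows "prob (good k K v \<inter> good k K w) \<le> prob (good k K v) * branch_bound s"
proof (cases "s = n")
  case True
  have "prob (good k K v \<inter> good k K w) \<le> prob (good k K v) * 1"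
    using good_events[OF v] by (auto intro: finite_measure_mono)
  \<comment> \<open>Here \<open>v = w\<close>, and \<open>branch_bound n\<close> is
    \<open>exp (tilt * (K + 1))\<close>, which is at least 1.\<close>
  also have "\<dots> \<le> prob (good k K v) * branch_bound s"
    using True half_k_bounds tilt_pos K by (intro mult_left_mono) (auto simp: branch_bound_def)
  finally show ?thesis .
next
  case False
  then have sn: "s < n" using s by simp
  \<comment> \<open>In the first phase the shared part is at most \<open>barrier k K s\<close>. In
    the second, \<open>v\<close> ends below \<open>shifted k + 1\<close> after travelling at least
    \<open>late_barrier K s\<close>, so the shared part is at most their difference; the
    \<open>- 1\<close> is the width of the end interval.\<close>
  define c where "c = (if s \<le> half n then shifted k - barrier k K s else late_barrier K s - 1)"
  define \<tau> where "\<tau> = sqrt (var_at n n - var_at n s)"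
  have \<tau>: "\<tau> > 0" "\<tau>\<^sup>2 = var_at n n - var_at n s" using var_at_less[OF sn] by (simp_all add: \<tau>_def)
  have dX: "distributed M lborel (disp s n w) (normal_density 0 \<tau>)"
    unfolding \<tau>_def using w sn by (intro distributed_displacement) auto
  have meas: "disp s n w \<in> borel_measurable M"
    using w sn by (intro measurable_displacement) auto
  have q: "prob {\<omega> \<in> space M. disp s n w \<omega> \<ge> c} \<le> branch_bound s"
  proof (cases "s \<le> half n")
    case True
    have "prob {\<omega> \<in> space M. disp s n w \<omega> \<ge> c} \<le> exp (tilt\<^sup>2 * \<tau>\<^sup>2 / 2 - tilt * c) / (tilt * \<tau>)"
      using \<tau> tilt_pos by (intro normal_tail_le_exp_div dX)
    also have "\<dots> \<le> exp (tilt\<^sup>2 * \<tau>\<^sup>2 / 2 - tilt * c) / (tilt * (\<sigma>\<^sub>1 * sqrt n / 2))"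
    proof (intro divide_left_mono mult_left_mono mult_pos_pos)
      show "\<sigma>\<^sub>1 * sqrt n / 2 \<le> \<tau>"
        unfolding \<tau>_def using True half_k_bounds sn by (intro sqrt_var_at_ge) auto
    qed (use tilt_pos \<tau> pos n_pos in auto)
    also have "exp (tilt\<^sup>2 * \<tau>\<^sup>2 / 2 - tilt * c) =
        scale k * sqrt n * exp (tilt * K + (ln 2 - gap / 2) * real (s - k))"
    proof -
      have "tilt\<^sup>2 * \<tau>\<^sup>2 / 2 = tilt\<^sup>2 * (var_at n n - \<sigma>\<^sub>1\<^sup>2 * real k) / 2 - tilt\<^sup>2 * \<sigma>\<^sub>1\<^sup>2 / 2 * real (s - k)"
        unfolding \<tau>(2) var_at_first[OF True] using s by (simp add: algebra_simps diff_divide_distrib)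
      moreover have "tilt * c = tilt * shifted k - (2 * (tilt\<^sup>2 * \<sigma>\<^sub>1\<^sup>2 / 2) + tilt * slack) * real (s - k) - tilt * K"
        using True by (simp add: c_def algebra_simps power2_eq_square del: of_nat_diff)
      \<comment> \<open>The rate stays below ln 2 by \<open>gap / 2\<close>: the shrinking number
        2^(n - s) of partners outweighs this growth in \<open>s\<close>.\<close>
      ultimately have "tilt\<^sup>2 * \<tau>\<^sup>2 / 2 - tilt * c =
        (tilt\<^sup>2 * (var_at n n - \<sigma>\<^sub>1\<^sup>2 * real k) / 2 - tilt * shifted k) +
        (tilt * K + (ln 2 - gap / 2) * real (s - k))"
        unfolding gap_eq tilt_slack by (simp add: algebra_simps add_divide_distrib del: of_nat_diff)
      then show ?thesis unfolding scale_eq[OF n_pos, symmetric] by (simp only: exp_add)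
    qed
    also have "scale k * sqrt n * exp (tilt * K + (ln 2 - gap / 2) * real (s - k)) / (tilt * (\<sigma>\<^sub>1 * sqrt n / 2)) = branch_bound s"
      using True n_pos by (simp add: branch_bound_def)
    finally show ?thesis .
  next
    case False
    \<comment> \<open>Chernoff's bound suffices: the exponent no longer contains the centering,
      hence no sqrt n has to be cancelled. The rate found next exceeds ln 2 by
      \<open>gap / 2\<close> and beats the 2^(n - s) partners.\<close>
    have "prob {\<omega> \<in> space M. disp s n w \<omega> \<ge> c} \<le> exp (tilt\<^sup>2 * \<tau>\<^sup>2 / 2 - tilt * c)"
      using \<tau> tilt_pos by (intro normal_tail_le_exp dX) auto
    also have "tilt\<^sup>2 * \<tau>\<^sup>2 / 2 - tilt * c = tilt * (K + 1) - (ln 2 + gap / 2) * real (n - s)"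
    proof -
      have "var_at n n - var_at n s = \<sigma>\<^sub>2\<^sup>2 * real (n - s)" using False s by (intro var_at_last) auto
      then have "tilt\<^sup>2 * \<tau>\<^sup>2 / 2 = tilt\<^sup>2 * \<sigma>\<^sub>2\<^sup>2 / 2 * real (n - s)" unfolding \<tau>(2) by simp
      moreover have "tilt * c = (2 * (tilt\<^sup>2 * \<sigma>\<^sub>2\<^sup>2 / 2) - tilt * slack) * real (n - s) - tilt * (K + 1)"
        using False by (simp add: c_def algebra_simps power2_eq_square del: of_nat_diff)
      ultimately show ?thesis
        unfolding gap_eq tilt_slack by (simp add: algebra_simps add_divide_distrib del: of_nat_diff)
    qed
    finally show ?thesis using False by (simp add: branch_bound_def)
  qed
  have "prob (good k K v \<inter> good k K w) \<le> prob (good k K v \<inter> {\<omega> \<in> space M. disp s n w \<omega> \<ge> c})"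
  proof (rule finite_measure_mono)
    show "good k K v \<inter> {\<omega> \<in> space M. disp s n w \<omega> \<ge> c} \<in> events"
      using good_events[OF v] meas by (intro sets.Int borel_measurable_le borel_measurable_const)
    show "good k K v \<inter> good k K w \<subseteq> good k K v \<inter> {\<omega> \<in> space M. disp s n w \<omega> \<ge> c}"
    proof
      fix \<omega> assume \<omega>: "\<omega> \<in> good k K v \<inter> good k K w"
      have kk: "take k v = take k w" using arg_cong[OF eq, of "take k"] s by (simp add: min_def)
      have gv: "disp k n v \<omega> \<le> shifted k + 1" "\<omega> \<in> space M"
          "s \<le> half n \<Longrightarrow> disp k s v \<omega> \<le> barrier k K s"
          "half n < s \<Longrightarrow> disp s n v \<omega> \<ge> late_barrier K s"
        using \<omega> s unfolding good_eq[OF v] by auto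
      have gw: "disp k n w \<omega> \<ge> shifted k" using \<omega> unfolding good_eq[OF w] by auto
      have "disp s n w \<omega> \<ge> c"
      proof (cases "s \<le> half n")
        case True
        then show ?thesis using gv(3) gw eq kk by (simp add: c_def)
      next
        case False
        then show ?thesis using gv(1,4) gw eq kk by (simp add: c_def)
      qed
      then show "\<omega> \<in> good k K v \<inter> {\<omega> \<in> space M. disp s n w \<omega> \<ge> c}" using \<omega> gv(2) by simp
    qed
  qed
  also have "\<dots> = prob (good k K v) * prob {\<omega> \<in> space M. disp s n w \<omega> \<ge> c}"
    using v w s(1) sn split by (intro good_tail_prob_eq) auto
  also have "\<dots> \<le> prob (good k K v) * branch_bound s"
    using q by (intro mult_left_mono) auto
  finally show ?thesis .
qed

text \<open>Only increments after time \<open>k\<close> enter \<open>good\<close>, and particles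
  with different ancestors at time \<open>k\<close> have disjoint lines from then on.\<close>

lemma good_inter_eq:
  assumes v: "length v = n" and w: "length w = n" and ne: "take k v \<noteq> take k w"
  shows "prob (good k K v \<inter> good k K w) = prob (good k K v) * prob (good k K w)"
proof -
  \<comment> \<open>Empty prefixes agree, so \<open>k\<close> is positive;
    \<open>ancestry_disjoint\<close> takes the predecessor of \<open>k\<close> as its split
    level.\<close>
  obtain s where s: "k = Suc s" using ne by (cases k) auto
  have "prob {\<omega> \<in> space M. admissible k K v (\<lambda>u. incr u \<omega>) \<and> admissible k K w (\<lambda>u. incr u \<omega>)} =
    prob {\<omega> \<in> space M. admissible k K v (\<lambda>u. incr u \<omega>)} * prob {\<omega> \<in> space M. admissible k K w (\<lambda>u. incr u \<omega>)}"
  proof (rule prob_disjoint_words)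
    show "ancestry k n v \<inter> ancestry k n w = {}"
      using v w ne[unfolded s] by (rule ancestry_disjoint) (simp add: s)
    show "ancestry k n v \<subseteq> words" "ancestry k n w \<subseteq> words"
      using v w by (intro ancestry_subset_particles; simp)+
  qed (rule admissible_measurable admissible_restrict)+
  moreover have "good k K v \<inter> good k K w = {\<omega> \<in> space M. admissible k K v (\<lambda>u. incr u \<omega>) \<and> admissible k K w (\<lambda>u. incr u \<omega>)}"
    unfolding good_def by blast
  ultimately show ?thesis unfolding good_def by simp
qed

end

section \<open>Tightness\<close>

lemma exists_exp_less:
  fixes A c \<delta> :: real
  assumes "A > 0" "c > 0" "\<delta> > 0"
  shows "\<exists>x\<^sub>0. \<forall>x\<ge>x\<^sub>0. A * exp (- c * x) < \<delta>"
proof (intro exI allI impI)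
  fix x assume "x \<ge> (ln (A / \<delta>) + 1) / c"
  then have "- c * x < - ln (A / \<delta>)" using assms by (simp add: divide_le_eq mult.commute)
  then have "exp (- c * x) < exp (- ln (A / \<delta>))" by simp
  also have "\<dots> = \<delta> / A" using assms by (simp add: exp_minus)
  finally show "A * exp (- c * x) < \<delta>" using assms by (simp add: field_simps)
qed

context increasing_variances
begin

text \<open>The two summands come from splits in the first and in the second phase, the denominator
  \<open>1 - exp (- gap / 2)\<close> from the geometric series, and \<open>2 / low\<close> from
  dividing by the expected count. Neither \<open>n\<close> nor \<open>k\<close> enters.\<close>

definition none_const :: "real \<Rightarrow> real" where
  "none_const K = 2 / low * ((2 / (tilt * \<sigma>\<^sub>1) * exp (tilt * K) +
     exp (tilt * (K + 1)) / exp (- tilt\<^sup>2 * (\<sigma>\<^sub>2\<^sup>2 - \<sigma>\<^sub>1\<^sup>2) / 4)) / (1 - exp (- gap / 2)))"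

lemma none_const_pos: "none_const K > 0"
proof -
  have "exp (- gap / 2) < 1" using gap_pos by simp
  moreover have "2 / (tilt * \<sigma>\<^sub>1) * exp (tilt * K) > 0" using tilt_pos pos by simp
  ultimately show ?thesis using low_pos unfolding none_const_def
    by (intro mult_pos_pos divide_pos_pos add_pos_pos) (use tilt_pos pos in auto)
qed

lemma half_pow_le: "(1 / 2) ^ k \<le> exp (- (tilt\<^sup>2 * \<sigma>\<^sub>1\<^sup>2 / 2) * real k)"
proof -
  have "(1 / 2 :: real) ^ k = exp (real k * - ln 2)"
    by (simp only: exp_of_nat_mult) (simp add: exp_minus)
  also have "\<dots> \<le> exp (- (tilt\<^sup>2 * \<sigma>\<^sub>1\<^sup>2 / 2) * real k)"
  proof -
    have "tilt\<^sup>2 * \<sigma>\<^sub>1\<^sup>2 / 2 * real k \<le> ln 2 * real k"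
      using gap_pos by (intro mult_right_mono) (simp_all add: gap_eq)
    then show ?thesis by (simp add: mult.commute)
  qed
  finally show ?thesis .
qed

lemma center_formulas:
  "center m = sqrt ((\<sigma>\<^sub>1\<^sup>2 + \<sigma>\<^sub>2\<^sup>2) * ln 2) * real m - sqrt (\<sigma>\<^sub>1\<^sup>2 + \<sigma>\<^sub>2\<^sup>2) / (4 * sqrt (ln 2)) * ln (real m)"
  "center m = sqrt (2 * ln 2) * sqrt ((\<sigma>\<^sub>1\<^sup>2 + \<sigma>\<^sub>2\<^sup>2) / 2) * real m -
     1 / 2 * (sqrt ((\<sigma>\<^sub>1\<^sup>2 + \<sigma>\<^sub>2\<^sup>2) / 2) / sqrt (2 * ln 2)) * ln (real m)"
proof -
  have t: "tilt = sqrt (2 * ln 2) / sqrt eff" by (simp add: tilt_def real_sqrt_divide)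
  have te: "tilt * eff = sqrt (2 * ln 2) * sqrt eff"
    using eff_pos unfolding t by (simp add: field_simps)
  have it: "1 / (2 * tilt) = 1 / 2 * (sqrt eff / sqrt (2 * ln 2))" by (simp add: t)
  have "center m = tilt * eff * real m - 1 / (2 * tilt) * ln (real m)" by (simp add: center_def)
  then show 2: "center m = sqrt (2 * ln 2) * sqrt ((\<sigma>\<^sub>1\<^sup>2 + \<sigma>\<^sub>2\<^sup>2) / 2) * real m -
     1 / 2 * (sqrt ((\<sigma>\<^sub>1\<^sup>2 + \<sigma>\<^sub>2\<^sup>2) / 2) / sqrt (2 * ln 2)) * ln (real m)"
    unfolding te it by (simp only: eff_def)
  have "sqrt (2 * ln 2) * sqrt ((\<sigma>\<^sub>1\<^sup>2 + \<sigma>\<^sub>2\<^sup>2) / 2) = sqrt ((\<sigma>\<^sub>1\<^sup>2 + \<sigma>\<^sub>2\<^sup>2) * ln 2)"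
    by (simp flip: real_sqrt_mult)
  moreover have "1 / 2 * (sqrt ((\<sigma>\<^sub>1\<^sup>2 + \<sigma>\<^sub>2\<^sup>2) / 2) / sqrt (2 * ln 2)) = sqrt (\<sigma>\<^sub>1\<^sup>2 + \<sigma>\<^sub>2\<^sup>2) / (4 * sqrt (ln 2))"
  proof -
    have "sqrt ((\<sigma>\<^sub>1\<^sup>2 + \<sigma>\<^sub>2\<^sup>2) / 2) / sqrt (2 * ln 2) = sqrt ((\<sigma>\<^sub>1\<^sup>2 + \<sigma>\<^sub>2\<^sup>2) / (4 * ln 2))"
      by (simp flip: real_sqrt_divide)
    also have "\<dots> = sqrt (\<sigma>\<^sub>1\<^sup>2 + \<sigma>\<^sub>2\<^sup>2) / (2 * sqrt (ln 2))" by (simp add: real_sqrt_divide real_sqrt_mult)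
    finally show ?thesis by simp
  qed
  ultimately show "center m = sqrt ((\<sigma>\<^sub>1\<^sup>2 + \<sigma>\<^sub>2\<^sup>2) * ln 2) * real m - sqrt (\<sigma>\<^sub>1\<^sup>2 + \<sigma>\<^sub>2\<^sup>2) / (4 * sqrt (ln 2)) * ln (real m)"
    using 2 by simp
qed

end

context increasing_brw
begin

lemma measurable_max_displacement: "max_displacement n S \<in> borel_measurable M"
proof -
  have "(\<lambda>\<omega>. Max ((\<lambda>v. S v \<omega>) ` particles n)) \<in> borel_measurable M"
    by (intro borel_measurable_Max measurable_position finite_particles) (simp add: particles_def)
  then show ?thesis by (simp add: max_displacement_def[abs_def])
qed

lemma max_displacement_ge: "v \<in> particles n \<Longrightarrow> S v \<omega> \<le> max_displacement n S \<omega>"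
  unfolding max_displacement_def by (intro Max_ge) auto

lemma max_displacement_attained: "\<exists>v\<in>particles n. max_displacement n S \<omega> = S v \<omega>"
proof -
  have "particles n \<noteq> {}" using card_particles[of n] by (metis card.empty power_not_zero zero_neq_numeral)
  then have "max_displacement n S \<omega> \<in> (\<lambda>v. S v \<omega>) ` particles n"
    unfolding max_displacement_def by (intro Max_in) auto
  then show ?thesis by auto
qed

text \<open>A union bound over time \<open>k\<close> with Chernoff's bound at tilt 1. A crude tilt
  is enough because \<open>k\<close> stays fixed while \<open>L\<close> is chosen large.\<close>

lemma prob_early_low_le:
  assumes "1 \<le> k" "k \<le> half n" "k \<le> n"
  shows "prob {\<omega> \<in> space M. \<exists>u\<in>particles k. S u \<omega> \<le> - L} \<le> 2 ^ k * exp (\<sigma>\<^sub>1\<^sup>2 * real k / 2 - L)"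
proof -
  have le: "prob {\<omega> \<in> space M. S u \<omega> \<le> - L} \<le> exp (\<sigma>\<^sub>1\<^sup>2 * real k / 2 - L)" if u: "u \<in> particles k" for u
  proof -
    have lu: "length u = k" using u by (simp add: particles_def)
    define \<tau> where "\<tau> = sqrt (var_at n k - var_at n 0)"
    have \<tau>2: "\<tau>\<^sup>2 = \<sigma>\<^sub>1\<^sup>2 * real k" unfolding \<tau>_def using assms by (simp add: var_at_first)
    have \<tau>: "\<tau> > 0" using var_at_less[of 0 k] assms by (simp add: \<tau>_def)
    have "distributed M lborel (disp 0 k u) (normal_density 0 \<tau>)"
      unfolding \<tau>_def using assms lu by (intro distributed_displacement) auto
    from normal_density_affine[OF this \<tau>, of "-1" 0]
    have d: "distributed M lborel (\<lambda>\<omega>. - disp 0 k u \<omega>) (normal_density 0 \<tau>)" by simp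
    have "prob {\<omega> \<in> space M. - disp 0 k u \<omega> \<ge> L} \<le> exp (1\<^sup>2 * \<tau>\<^sup>2 / 2 - 1 * L)"
      using \<tau> by (intro normal_tail_le_exp d) auto
    also have "{\<omega> \<in> space M. - disp 0 k u \<omega> \<ge> L} = {\<omega> \<in> space M. S u \<omega> \<le> - L}"
      using lu by (auto simp: root)
    finally show ?thesis by (simp add: \<tau>2)
  qed
  have "{\<omega> \<in> space M. \<exists>u\<in>particles k. S u \<omega> \<le> - L} = (\<Union>u\<in>particles k. {\<omega> \<in> space M. S u \<omega> \<le> - L})"
    by auto
  also have "prob \<dots> \<le> (\<Sum>u\<in>particles k. prob {\<omega> \<in> space M. S u \<omega> \<le> - L})"
  proof (rule finite_measure_subadditive_finite)
    have "{\<omega> \<in> space M. S u \<omega> \<le> - L} \<in> events" if "u \<in> particles k" for u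
      using measurable_position[of u] that assms by (auto simp: particles_def)
    then show "(\<lambda>u. {\<omega> \<in> space M. S u \<omega> \<le> - L}) ` particles k \<subseteq> events" by auto
  qed simp
  also have "\<dots> \<le> (\<Sum>u\<in>particles k. exp (\<sigma>\<^sub>1\<^sup>2 * real k / 2 - L))" by (intro sum_mono le)
  finally show ?thesis by (simp add: card_particles)
qed

end

section \<open>Second moment bound and the lower tail\<close>

context barrier_brw
begin

text \<open>Weighted with the number of partners, the terms decay geometrically with ratio
  \<open>exp (- gap / 2)\<close> away from \<open>k\<close> in the first phase and away from
  \<open>n\<close> in the second.\<close>

lemma sum_branch_bound_le:
  "(\<Sum>s\<in>{k..n}. 2 ^ (n - s) * branch_bound s) \<le>
    2 ^ n * scale k * (low / 2) * (none_const K * exp (- (tilt\<^sup>2 * \<sigma>\<^sub>1\<^sup>2 / 2) * real k))"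
proof -
  define d where "d = exp (- gap / 2)"
  define Z where "Z = 2 ^ n * scale k"
  define X where "X = exp (- (tilt\<^sup>2 * \<sigma>\<^sub>1\<^sup>2 / 2) * real k)"
  define c\<^sub>0 where "c\<^sub>0 = exp (- tilt\<^sup>2 * (\<sigma>\<^sub>2\<^sup>2 - \<sigma>\<^sub>1\<^sup>2) / 4)"
  define A where "A = 2 / (tilt * \<sigma>\<^sub>1) * exp (tilt * K)"
  define B where "B = exp (tilt * (K + 1))"
  have d: "0 \<le> d" "d < 1" using gap_pos by (simp_all add: d_def)
  have Z: "Z > 0" using scale_pos[OF n_pos, of k] by (simp add: Z_def)
  have A: "A \<ge> 0" using tilt_pos pos by (simp add: A_def)
  have X: "X > 0" by (simp add: X_def)
  \<comment> \<open>Second-phase terms carry no factor \<open>scale k\<close>; by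
    \<open>scale_ge\<close> this inequality inserts it at the price of the constant
    \<open>c\<^sub>0\<close>.\<close>
  have ZX: "1 \<le> Z * (X / c\<^sub>0)"
  proof -
    let ?W = "exp (tilt\<^sup>2 * \<sigma>\<^sub>1\<^sup>2 * real k / 2)"
    have "c\<^sub>0 * ?W \<le> Z" unfolding c\<^sub>0_def Z_def by (rule scale_ge[OF n_pos])
    then have "c\<^sub>0 * ?W * (X / c\<^sub>0) \<le> Z * (X / c\<^sub>0)"
      using X by (intro mult_right_mono) (simp_all add: c\<^sub>0_def)
    moreover have "?W * X = 1" unfolding X_def exp_add[symmetric] by simp
    moreover have "c\<^sub>0 * ?W * (X / c\<^sub>0) = ?W * X" by (simp add: c\<^sub>0_def)
    ultimately show ?thesis by linarith
  qed
  have 1: "2 ^ (n - s) * branch_bound s \<le> Z * X * A * d ^ (s - k)" if s: "s \<in> {k..half n}" for s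
  proof -
    have "exp ((ln 2 - gap / 2) * real (s - k)) = 2 ^ (s - k) * d ^ (s - k)"
    proof -
      have "exp ((ln 2 - gap / 2) * real (s - k)) = exp (real (s - k) * ln 2 + real (s - k) * (- gap / 2))"
        by (simp add: algebra_simps del: of_nat_diff)
      then show ?thesis unfolding exp_add exp_of_nat_mult d_def by simp
    qed
    then have b: "branch_bound s = scale k * A * (2 ^ (s - k) * d ^ (s - k))"
      using s by (simp add: branch_bound_def A_def exp_add)
    have e: "(n - s) + (s - k) = n - k" using s half_k_bounds by simp
    have "2 ^ (n - s) * 2 ^ (s - k) = (2::real) ^ (n - k)"
      unfolding power_add[symmetric] e ..
    also have "\<dots> = 2 ^ n * (1 / 2) ^ k" using half_k_bounds by (simp add: power_diff power_divide)
    finally have p: "2 ^ (n - s) * 2 ^ (s - k) = (2::real) ^ n * (1 / 2) ^ k" .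
    have "2 ^ (n - s) * branch_bound s = (2 ^ (n - s) * 2 ^ (s - k)) * (scale k * A * d ^ (s - k))"
      unfolding b by (simp only: mult_ac)
    also have "\<dots> = Z * A * d ^ (s - k) * (1 / 2) ^ k"
      unfolding p Z_def by (simp only: mult_ac)
    finally have "2 ^ (n - s) * branch_bound s = Z * A * d ^ (s - k) * (1 / 2) ^ k" .
    also have "\<dots> \<le> Z * A * d ^ (s - k) * X"
      unfolding X_def using half_pow_le Z A d by (intro mult_left_mono) auto
    finally show ?thesis by (simp add: mult_ac)
  qed
  have 2: "2 ^ (n - s) * branch_bound s \<le> Z * X * (B / c\<^sub>0) * d ^ (n - s)" if s: "s \<in> {half n<..n}" for s
  proof -
    have "tilt * (K + 1) - (ln 2 + gap / 2) * real (n - s) =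
        tilt * (K + 1) + (real (n - s) * (- ln 2) + real (n - s) * (- gap / 2))"
      by (simp add: algebra_simps del: of_nat_diff)
    then have "branch_bound s = B * ((1 / 2) ^ (n - s) * d ^ (n - s))"
      using s by (simp only: branch_bound_def greaterThanAtMost_iff not_le[symmetric] if_False simp_thms
          exp_add exp_of_nat_mult d_def B_def) (simp add: exp_minus)
    then have "2 ^ (n - s) * branch_bound s = 1 * (B * d ^ (n - s))"
      by (simp add: power_divide)
    also have "\<dots> \<le> Z * (X / c\<^sub>0) * (B * d ^ (n - s))"
      using ZX d by (intro mult_right_mono) (auto simp: B_def)
    finally show ?thesis by (simp add: mult_ac)
  qed
  have split: "{k..n} = {k..half n} \<union> {half n<..n}" using half_k_bounds by auto
  have "(\<Sum>s\<in>{k..n}. 2 ^ (n - s) * branch_bound s) =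
      (\<Sum>s\<in>{k..half n}. 2 ^ (n - s) * branch_bound s) + (\<Sum>s\<in>{half n<..n}. 2 ^ (n - s) * branch_bound s)"
    unfolding split by (rule sum.union_disjoint) auto
  also have "\<dots> \<le> (\<Sum>s\<in>{k..half n}. Z * X * A * d ^ (s - k)) + (\<Sum>s\<in>{half n<..n}. Z * X * (B / c\<^sub>0) * d ^ (n - s))"
    by (intro add_mono sum_mono 1 2)
  also have "\<dots> \<le> Z * X * A * (1 / (1 - d)) + Z * X * (B / c\<^sub>0) * (1 / (1 - d))"
    unfolding sum_distrib_left[symmetric] using d Z X A
    by (intro add_mono mult_left_mono sum_geometric_le) (auto simp: inj_on_def B_def c\<^sub>0_def)
  also have "\<dots> = Z * (X * ((A + B / c\<^sub>0) / (1 - d)))" by (simp add: distrib_left add_divide_distrib)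
  also have "(A + B / c\<^sub>0) / (1 - d) = low / 2 * none_const K"
  proof -
    have "low / 2 * (2 / low * x) = x" for x using low_pos by simp
    then show ?thesis unfolding none_const_def A_def B_def c\<^sub>0_def d_def by (rule sym)
  qed
  finally show ?thesis unfolding Z_def X_def by (simp only: mult_ac)
qed

text \<open>The second moment method with \<open>R\<close> the pairs sharing their ancestor at time
  \<open>k\<close>. Each row of the correlated sum is at most \<open>g v * Q\<close>, so the
  quotient reduces to \<open>Q / G\<close>.\<close>

lemma prob_no_good_le:
  "prob (space M - (\<Union>v\<in>particles n. good k K v)) \<le> none_const K * exp (- (tilt\<^sup>2 * \<sigma>\<^sub>1\<^sup>2 / 2) * real k)"
proof -
  define g where "g v = prob (good k K v)" for v
  define G where "G = (\<Sum>v\<in>particles n. g v)"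
  define Q where "Q = (\<Sum>s\<in>{k..n}. 2 ^ (n - s) * branch_bound s)"
  define R where "R = {(v :: bool list, w). take k v = take k w}"
  define Y where "Y = none_const K * exp (- (tilt\<^sup>2 * \<sigma>\<^sub>1\<^sup>2 / 2) * real k)"
  have g0: "g v \<ge> 0" for v by (simp add: g_def)
  have G: "2 ^ n * scale k * (low / 2) \<le> G"
  proof -
    have "(\<Sum>v\<in>particles n. low / 2 * scale k) \<le> G"
      unfolding G_def g_def by (intro sum_mono good_prob_ge) (simp add: particles_def)
    then show ?thesis by (simp add: card_particles mult_ac)
  qed
  have Gpos: "G > 0"
  proof -
    have "0 < 2 ^ n * scale k * (low / 2)" using scale_pos[OF n_pos, of k] low_pos by simp
    then show ?thesis using G by linarith
  qed
  have row: "(\<Sum>w\<in>particles n. if (v, w) \<in> R then prob (good k K v \<inter> good k K w) else 0) \<le> g v * Q"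
    if v: "v \<in> particles n" for v
  proof -
    have lv: "length v = n" using v by (simp add: particles_def)
    \<comment> \<open>Agreement up to \<open>s\<close> replaces a split exactly at \<open>s\<close>.
      This overcounts, but all terms are nonnegative and the true split level is among them; the
      inner count then becomes that of a common prefix.\<close>
    have "(\<Sum>w\<in>particles n. if (v, w) \<in> R then prob (good k K v \<inter> good k K w) else 0)
      \<le> (\<Sum>w\<in>particles n. \<Sum>s\<in>{k..n}. if take s w = take s v then g v * branch_bound s else 0)"
    proof (rule sum_mono)
      fix w assume "w \<in> particles n"
      then have lw: "length w = n" by (simp add: particles_def)
      let ?f = "\<lambda>s. if take s w = take s v then g v * branch_bound s else 0"
      have nonneg: "?f s \<ge> 0" for s using g0 branch_bound_nonneg by simp
      show "(if (v, w) \<in> R then prob (good k K v \<inter> good k K w) else 0) \<le> (\<Sum>s\<in>{k..n}. ?f s)"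
      proof (cases "(v, w) \<in> R")
        case True
        then have "take k v = take k w" by (simp add: R_def)
        moreover have "k \<le> n" using half_k_bounds by simp
        ultimately obtain s where s: "s \<in> {k..n}" "take s v = take s w" "s < n \<longrightarrow> take (Suc s) v \<noteq> take (Suc s) w"
          using exists_split_level[OF lv lw] by blast
        have "prob (good k K v \<inter> good k K w) \<le> g v * branch_bound s"
          unfolding g_def using s by (intro good_inter_le lv lw) auto
        also have "\<dots> = ?f s" using s(2) by simp
        also have "\<dots> \<le> (\<Sum>s\<in>{k..n}. ?f s)"
          using s(1) nonneg by (intro member_le_sum) auto
        finally show ?thesis using True by simp
      qed (use nonneg in \<open>simp add: sum_nonneg\<close>)
    qed
    also have "\<dots> = (\<Sum>s\<in>{k..n}. \<Sum>w\<in>particles n. if take s w = take s v then g v * branch_bound s else 0)"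
      by (rule sum.swap)
    also have "\<dots> = (\<Sum>s\<in>{k..n}. real (card {w \<in> particles n. take s w = take s v}) * (g v * branch_bound s))"
      by (intro sum.cong refl) (simp flip: sum.inter_filter)
    also have "\<dots> \<le> (\<Sum>s\<in>{k..n}. 2 ^ (n - s) * (g v * branch_bound s))"
    proof (intro sum_mono mult_right_mono)
      fix s assume "s \<in> {k..n}"
      then have "card {w \<in> particles n. take s w = take s v} \<le> 2 ^ (n - s)"
        using lv by (intro card_particles_prefix_le) simp
      then show "real (card {w \<in> particles n. take s w = take s v}) \<le> 2 ^ (n - s)"
        by (metis of_nat_le_iff of_nat_numeral of_nat_power)
    qed (use g0 branch_bound_nonneg in simp)
    also have "\<dots> = g v * Q" unfolding Q_def sum_distrib_left by (simp add: mult_ac)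
    finally show ?thesis .
  qed
  have "prob (space M - (\<Union>v\<in>particles n. good k K v)) \<le>
    (\<Sum>v\<in>particles n. \<Sum>w\<in>particles n. if (v, w) \<in> R then prob (good k K v \<inter> good k K w) else 0) / G\<^sup>2"
    unfolding G_def g_def
  proof (rule second_moment_none_le)
    show "prob (good k K v \<inter> good k K w) \<le> prob (good k K v) * prob (good k K w)"
      if "v \<in> particles n" "w \<in> particles n" "(v, w) \<notin> R" for v w
      using that good_inter_eq[of v w] by (simp add: R_def particles_def)
    show "good k K v \<in> events" if "v \<in> particles n" for v
      using that by (intro good_events) (simp add: particles_def)
  qed (use Gpos in \<open>simp_all add: G_def g_def\<close>)
  also have "\<dots> \<le> (\<Sum>v\<in>particles n. g v * Q) / G\<^sup>2"
    by (intro divide_right_mono sum_mono row) auto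
  also have "\<dots> = Q / G" using Gpos by (simp add: G_def power2_eq_square flip: sum_distrib_right)
  also have "\<dots> \<le> Y"
  proof -
    have "Q \<le> 2 ^ n * scale k * (low / 2) * Y" unfolding Q_def Y_def by (rule sum_branch_bound_le)
    also have "\<dots> \<le> G * Y" using G none_const_pos by (intro mult_right_mono) (auto simp: Y_def less_imp_le)
    finally show ?thesis using Gpos by (simp add: divide_le_eq mult.commute)
  qed
  finally show ?thesis unfolding Y_def .
qed

text \<open>Outside the two exceptional events some particle gains at least \<open>shifted k\<close>
  after time \<open>k\<close> and its ancestor at time \<open>k\<close> is above
  \<open>- L\<close>.\<close>

lemma prob_max_displacement_low_le:
  assumes "k \<ge> 1"
  shows "prob {\<omega> \<in> space M. max_displacement n S \<omega> < center n - tilt * \<sigma>\<^sub>1\<^sup>2 * real k - L}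
    \<le> none_const K * exp (- (tilt\<^sup>2 * \<sigma>\<^sub>1\<^sup>2 / 2) * real k) + 2 ^ k * exp (\<sigma>\<^sub>1\<^sup>2 * real k / 2 - L)"
proof -
  let ?N = "space M - (\<Union>v\<in>particles n. good k K v)"
  let ?U = "{\<omega> \<in> space M. \<exists>u\<in>particles k. S u \<omega> \<le> - L}"
  have kn: "k \<le> half n" "k \<le> n" using half_k_bounds by auto
  have "?U = (\<Union>u\<in>particles k. {\<omega> \<in> space M. S u \<omega> \<le> - L})" by auto
  moreover have "{\<omega> \<in> space M. S u \<omega> \<le> - L} \<in> events" if "u \<in> particles k" for u
    using measurable_position[of u] that kn by (auto simp: particles_def)
  ultimately have U: "?U \<in> events" by auto
  have "good k K v \<in> events" if "v \<in> particles n" for v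
    using that by (intro good_events) (simp add: particles_def)
  then have N: "?N \<in> events" by (intro sets.Diff sets.finite_UN) auto
  have "prob {\<omega> \<in> space M. max_displacement n S \<omega> < center n - tilt * \<sigma>\<^sub>1\<^sup>2 * real k - L} \<le> prob (?N \<union> ?U)"
  proof (rule finite_measure_mono)
    show "{\<omega> \<in> space M. max_displacement n S \<omega> < center n - tilt * \<sigma>\<^sub>1\<^sup>2 * real k - L} \<subseteq> ?N \<union> ?U"
    proof (rule subsetI, rule ccontr)
      fix \<omega> assume \<omega>: "\<omega> \<in> {\<omega> \<in> space M. max_displacement n S \<omega> < center n - tilt * \<sigma>\<^sub>1\<^sup>2 * real k - L}"
        and "\<omega> \<notin> ?N \<union> ?U"
      then obtain v where v: "v \<in> particles n" "\<omega> \<in> good k K v" and u: "\<forall>u\<in>particles k. S u \<omega> > - L"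
        by (auto simp: not_le)
      have lv: "length v = n" using v by (simp add: particles_def)
      then have "S (take k v) \<omega> > - L" using u kn by (simp add: particles_def)
      moreover have "S v \<omega> - S (take k v) \<omega> \<ge> shifted k" using v(2) lv unfolding good_eq[OF lv] by simp
      ultimately have "S v \<omega> > shifted k - L" by linarith
      then show False using max_displacement_ge[OF v(1), of \<omega>] \<omega> by (simp add: shifted_def)
    qed
  qed (intro sets.Un N U)
  also have "\<dots> \<le> prob ?N + prob ?U" by (rule measure_Un_le[OF N U])
  also have "\<dots> \<le> none_const K * exp (- (tilt\<^sup>2 * \<sigma>\<^sub>1\<^sup>2 / 2) * real k) + 2 ^ k * exp (\<sigma>\<^sub>1\<^sup>2 * real k / 2 - L)"
    by (intro add_mono prob_no_good_le prob_early_low_le assms kn)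
  finally show ?thesis .
qed

end

section \<open>Uniform tightness\<close>

context increasing_variances
begin

lemma bounded_in_probability_centered:
  fixes M :: "nat \<Rightarrow> 'a measure"
  assumes brw: "\<And>n. n \<ge> 1 \<Longrightarrow> two_variance_brw (M n) n \<sigma>\<^sub>1 \<sigma>\<^sub>2 (S n)"
  shows "bounded_in_probability M (\<lambda>n \<omega>. max_displacement n (S n) \<omega> - center n)"
proof -
  let ?R = "\<lambda>n \<omega>. max_displacement n (S n) \<omega> - center n"
  have inc: "increasing_brw (M n) n \<sigma>\<^sub>1 \<sigma>\<^sub>2 (S n)" if "n \<ge> 1" for n
    using brw[OF that] increasing_variances_axioms by (simp add: increasing_brw_def)
  have meas: "?R n \<in> borel_measurable (M n)" if "n \<ge> 1" for n
    using increasing_brw.measurable_max_displacement[OF inc[OF that]] by simp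
  obtain K where K: "K > 0" "4 / (\<sigma>\<^sub>1 * (1 - decay)) * exp (- slack * K / \<sigma>\<^sub>2\<^sup>2) \<le> low / 2"
    using exists_height by blast
  have "\<exists>B. \<forall>n\<ge>1. measure (M n) {\<omega> \<in> space (M n). \<bar>?R n \<omega>\<bar> > B} < \<epsilon>" if \<epsilon>: "\<epsilon> > 0" for \<epsilon>
  proof -
    obtain y where y: "\<And>x. x \<ge> y \<Longrightarrow> 1 / (tilt * \<sigma>\<^sub>1) * exp (- tilt * x) < \<epsilon> / 2"
      using exists_exp_less[of "1 / (tilt * \<sigma>\<^sub>1)" tilt "\<epsilon> / 2"] tilt_pos pos \<epsilon> by auto
    obtain x\<^sub>0 where x\<^sub>0: "\<And>x. x \<ge> x\<^sub>0 \<Longrightarrow> none_const K * exp (- (tilt\<^sup>2 * \<sigma>\<^sub>1\<^sup>2 / 2) * x) < \<epsilon> / 4"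
      using exists_exp_less[of "none_const K" "tilt\<^sup>2 * \<sigma>\<^sub>1\<^sup>2 / 2" "\<epsilon> / 4"] tilt_pos pos \<epsilon> none_const_pos by auto
    \<comment> \<open>The order of choices matters: \<open>k\<close> makes the second moment term
      small, and only then is \<open>L\<close> taken large, since the bound at time \<open>k\<close>
      has a factor growing with \<open>k\<close>.\<close>
    obtain k where k: "k \<ge> 1" "real k \<ge> x\<^sub>0"
      using real_arch_simple[of "max 1 x\<^sub>0"] by auto
    obtain L where L: "2 ^ k * exp (\<sigma>\<^sub>1\<^sup>2 * real k / 2) * exp (- 1 * L) < \<epsilon> / 4"
      using exists_exp_less[of "2 ^ k * exp (\<sigma>\<^sub>1\<^sup>2 * real k / 2)" 1 "\<epsilon> / 4"] \<epsilon> by auto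
    define B where "B = max y (tilt * \<sigma>\<^sub>1\<^sup>2 * real k + L)"
    have large: "measure (M n) {\<omega> \<in> space (M n). \<bar>?R n \<omega>\<bar> > B} < \<epsilon>" if n: "n \<ge> 4 * k + 4" for n
    proof -
      have n1: "n \<ge> 1" using n by simp
      interpret b: barrier_brw "M n" n \<sigma>\<^sub>1 \<sigma>\<^sub>2 "S n" k K
        using inc[OF n1] K n by (simp add: barrier_brw_def barrier_brw_axioms_def)
      let ?A = "{\<omega> \<in> space (M n). \<exists>v\<in>particles n. S n v \<omega> \<ge> center n + y}"
      let ?D = "{\<omega> \<in> space (M n). max_displacement n (S n) \<omega> < center n - tilt * \<sigma>\<^sub>1\<^sup>2 * real k - L}"
      note m [measurable] = b.measurable_max_displacement
      have D: "?D \<in> sets (M n)" by measurable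
      have "?A = (\<Union>v\<in>particles n. {\<omega> \<in> space (M n). S n v \<omega> \<ge> center n + y})" by auto
      moreover have "{\<omega> \<in> space (M n). S n v \<omega> \<ge> center n + y} \<in> sets (M n)" if "v \<in> particles n" for v
        using b.measurable_position[of v] that by (auto simp: particles_def)
      ultimately have A: "?A \<in> sets (M n)" by auto
      have "measure (M n) {\<omega> \<in> space (M n). \<bar>?R n \<omega>\<bar> > B} \<le> measure (M n) (?A \<union> ?D)"
      proof (rule b.finite_measure_mono)
        show "{\<omega> \<in> space (M n). \<bar>?R n \<omega>\<bar> > B} \<subseteq> ?A \<union> ?D"
        proof
          fix \<omega> assume \<omega>: "\<omega> \<in> {\<omega> \<in> space (M n). \<bar>?R n \<omega>\<bar> > B}"
          obtain v where v: "v \<in> particles n" "max_displacement n (S n) \<omega> = S n v \<omega>"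
            using b.max_displacement_attained by blast
          have "B \<ge> y" "B \<ge> tilt * \<sigma>\<^sub>1\<^sup>2 * real k + L" by (simp_all add: B_def)
          then have "S n v \<omega> \<ge> center n + y \<or> max_displacement n (S n) \<omega> < center n - tilt * \<sigma>\<^sub>1\<^sup>2 * real k - L"
            using \<omega> v(2) by (auto simp: abs_if split: if_splits)
          then show "\<omega> \<in> ?A \<union> ?D" using \<omega> v(1) by auto
        qed
      qed (intro sets.Un A D)
      also have "\<dots> \<le> measure (M n) ?A + measure (M n) ?D" by (rule measure_Un_le[OF A D])
      also have "\<dots> < \<epsilon> / 2 + (\<epsilon> / 4 + \<epsilon> / 4)"
      proof (rule add_less_le_mono)
        show "measure (M n) ?A < \<epsilon> / 2"
          using b.prob_above_center_le[OF n1, of y] y[OF order_refl] by (simp only: mult_1 times_divide_eq_left)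
        have "2 ^ k * exp (\<sigma>\<^sub>1\<^sup>2 * real k / 2 - L) = 2 ^ k * exp (\<sigma>\<^sub>1\<^sup>2 * real k / 2) * exp (- 1 * L)"
          unfolding mult.assoc exp_add[symmetric] by simp
        then show "measure (M n) ?D \<le> \<epsilon> / 4 + \<epsilon> / 4"
          using b.prob_max_displacement_low_le[OF k(1), of L] x\<^sub>0[OF k(2)] L by linarith
      qed
      finally show ?thesis by simp
    qed
    \<comment> \<open>The barrier estimates need \<open>n\<close> at least of order
      \<open>4 * k\<close>. The finitely many smaller \<open>n\<close> are bounded one by one and
      absorbed into the maximum \<open>B'\<close>.\<close>
    have "\<exists>K. 0 \<le> K \<and> measure (M n) {\<omega> \<in> space (M n). \<bar>?R n \<omega>\<bar> > K} < \<epsilon>" if "n \<ge> 1" for n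
    proof -
      interpret increasing_brw "M n" n \<sigma>\<^sub>1 \<sigma>\<^sub>2 "S n" using inc[OF that] .
      show ?thesis using exists_tail_bound[OF meas[OF that] \<epsilon>] by blast
    qed
    then obtain T where T: "\<And>n. n \<ge> 1 \<Longrightarrow> measure (M n) {\<omega> \<in> space (M n). \<bar>?R n \<omega>\<bar> > T n} < \<epsilon>"
      by metis
    define B' where "B' = Max (insert B (T ` {..<4 * k + 4}))"
    have "measure (M n) {\<omega> \<in> space (M n). \<bar>?R n \<omega>\<bar> > B'} < \<epsilon>" if n: "n \<ge> 1" for n
    proof -
      interpret increasing_brw "M n" n \<sigma>\<^sub>1 \<sigma>\<^sub>2 "S n" using inc[OF n] .
      define b where "b = (if n < 4 * k + 4 then T n else B)"
      have b: "measure (M n) {\<omega> \<in> space (M n). \<bar>?R n \<omega>\<bar> > b} < \<epsilon>"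
        using T[OF n] large[of n] by (simp add: b_def)
      have "b \<le> B'" unfolding B'_def by (intro Max_ge) (auto simp: b_def)
      moreover have "{\<omega> \<in> space (M n). \<bar>?R n \<omega>\<bar> > b} \<in> sets (M n)" using meas[OF n] by measurable
      ultimately have "measure (M n) {\<omega> \<in> space (M n). \<bar>?R n \<omega>\<bar> > B'} \<le> measure (M n) {\<omega> \<in> space (M n). \<bar>?R n \<omega>\<bar> > b}"
        by (intro finite_measure_mono) auto
      then show ?thesis using b by linarith
    qed
    then show ?thesis by blast
  qed
  then show ?thesis using meas unfolding bounded_in_probability_def by blast
qed

end

theorem theorem1:
  fixes \<sigma>\<^sub>1 \<sigma>\<^sub>2 :: real
    and M :: "nat \<Rightarrow> 'a measure"
    and S :: "nat \<Rightarrow> bool list \<Rightarrow> 'a \<Rightarrow> real"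
  assumes "\<sigma>\<^sub>1 > 0" and "\<sigma>\<^sub>2 > 0" and "\<sigma>\<^sub>1\<^sup>2 < \<sigma>\<^sub>2\<^sup>2"
    and "\<And>n. n \<ge> 1 \<Longrightarrow> two_variance_brw (M n) n \<sigma>\<^sub>1 \<sigma>\<^sub>2 (S n)"
  shows "bounded_in_probability M (\<lambda>n \<omega>. max_displacement n (S n) \<omega> -
           (sqrt ((\<sigma>\<^sub>1\<^sup>2 + \<sigma>\<^sub>2\<^sup>2) * ln 2) * real n -
            sqrt (\<sigma>\<^sub>1\<^sup>2 + \<sigma>\<^sub>2\<^sup>2) / (4 * sqrt (ln 2)) * ln (real n))) \<and>
         (let \<sigma>\<^sub>e = sqrt ((\<sigma>\<^sub>1\<^sup>2 + \<sigma>\<^sub>2\<^sup>2) / 2); \<beta> = 1 / 2 in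
          (\<forall>n\<ge>1. sqrt ((\<sigma>\<^sub>1\<^sup>2 + \<sigma>\<^sub>2\<^sup>2) * ln 2) * real n -
              sqrt (\<sigma>\<^sub>1\<^sup>2 + \<sigma>\<^sub>2\<^sup>2) / (4 * sqrt (ln 2)) * ln (real n) =
              sqrt (2 * ln 2) * \<sigma>\<^sub>e * real n - \<beta> * (\<sigma>\<^sub>e / sqrt (2 * ln 2)) * ln (real n)) \<and>
          bounded_in_probability M (\<lambda>n \<omega>. max_displacement n (S n) \<omega> -
           (sqrt (2 * ln 2) * \<sigma>\<^sub>e * real n - \<beta> * (\<sigma>\<^sub>e / sqrt (2 * ln 2)) * ln (real n))))"
proof -
  interpret increasing_variances \<sigma>\<^sub>1 \<sigma>\<^sub>2 by unfold_locales (rule assms)+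
  have "bounded_in_probability M (\<lambda>n \<omega>. max_displacement n (S n) \<omega> - center n)"
    by (rule bounded_in_probability_centered) (rule assms)
  then show ?thesis
    unfolding Let_def center_formulas(1)[symmetric] center_formulas(2)[symmetric] by simp
qed

end
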